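(* Let $k>1$ be an integer, $t>0$, $p\in(0,1)$, $\lambda>0$, and let $X_{ij}$ ($1\le i\le k$, $j\ge1$) be mutually independent random variables with $X_{ij}\sim\mathrm{Poisson}(m_i)$, $m_i=p(1-p)^{i-1}\lambda t$. Let $(\hat p_n,\hat\lambda_n)$ be the maximum likelihood estimator of $(p,\lambda)$ based on $(X_{ij})_{1\le i\le k,\,1\le j\le n}$, i.e. the solution of the score equations. Then $(\hat p_n,\hat\lambda_n)$ is strongly consistent, $$(\hat p_n,\hat\lambda_n)\to(p,\lambda)\quad\text{almost surely as } n\to\infty,$$ and asymptotically normal, $$\sqrt n\,\big((\hat p_n,\hat\lambda_n)-(p,\lambda)\big)\xrightarrow{d}\mathcal N\big(\mathbf 0,[\mathbf I(p,\lambda)]^{-1}\big)\quad\text{as } n\to\infty,$$ where $\mathbf I(p,\lambda)=\sum_{i=1}^k\mathbf I_{(i)}(p,\lambda)$ and $\mathbf I_{(i)}(p,\lambda)$ is the $2\times2$ Fisher information matrix, with respect to the parameters $(p,\lambda)$, of the probability mass function $f_i(x\mid p,\lambda)=e^{-m_i}m_i^{x}/x!$ of a single observation $X_{ij}$ with $i$ fixed.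
   Context: Setting: a neutron detector has $k$ layers; the experiment is repeated $n$ times independently, each over a time interval of length $t$; $X_{ij}$ is the number of neutrons detected at layer $i$ in round $j$; $p$ is the absorption probability at each layer and $\lambda$ the intensity of the incoming Poisson process. Score equations. Put $s_n=\frac1n\sum_{j=1}^n\sum_{i=1}^kX_{ij}$ and $z_n=\frac1n\sum_{j=1}^n\sum_{i=1}^k(i-1)X_{ij}$. The log-likelihood is $l_n(p,\lambda)=\sum_{j=1}^n\sum_{i=1}^k(-m_i+X_{ij}\log m_i-\log X_{ij}!)$, and the score equations for the unknowns $(p,\lambda)\in(0,1)\times(0,\infty)$ are $$\frac{s_n-\lambda t(1-(1-p)^k)}{\lambda}=0,\qquad \frac{(1-p)(s_n+z_n)-z_n-\lambda t\,(k(1-p)^k-k(1-p)^{k+1})}{p(1-p)}=0.$$ Convention: $(\hat p_n,\hat\lambda_n)$ denotes the solution in $(0,1)\times(0,\infty)$ of these equations on the event that there is exactly one such solution; on the complement of this event it is given an arbitrary measurable value in $[0,1]\times[0,\infty)$. *)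

theory Defs
  imports "HOL-Probability.Probability"
begin

subsection \<open>Convergence in distribution and normal laws in finite dimension\<close>

text \<open>The library's weak convergence only covers measures on the real line, hence the
  definition by bounded continuous test functions.\<close>

definition converges_in_distribution ::
    "'a measure \<Rightarrow> (nat \<Rightarrow> 'a \<Rightarrow> 'b::topological_space) \<Rightarrow> 'b measure \<Rightarrow> bool" where
  "converges_in_distribution M Y N \<longleftrightarrow>
     (\<forall>f::'b \<Rightarrow> real. continuous_on UNIV f \<and> bounded (range f) \<longrightarrow>
        (\<lambda>n. \<integral>\<omega>. f (Y n \<omega>) \<partial>M) \<longlonglongrightarrow> (\<integral>x. f x \<partial>N))"

text \<open>The density form is meaningful for positive definite \<open>\<Sigma>\<close> only.\<close>

definition multivariate_normal :: "real^'n \<Rightarrow> real^'n^'n \<Rightarrow> (real^'n) measure" where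
  "multivariate_normal \<mu> \<Sigma> = density lborel (\<lambda>x. ennreal
     (exp (- ((x - \<mu>) \<bullet> (matrix_inv \<Sigma> *v (x - \<mu>))) / 2) / sqrt ((2 * pi) ^ CARD('n) * det \<Sigma>)))"

subsection \<open>Fisher information\<close>

definition score :: "(real^'n \<Rightarrow> 'x pmf) \<Rightarrow> real^'n \<Rightarrow> 'n \<Rightarrow> 'x \<Rightarrow> real" where
  "score F \<theta> a x = deriv (\<lambda>h. ln (pmf (F (\<theta> + h *\<^sub>R axis a 1)) x)) 0"

definition fisher_information :: "(real^'n \<Rightarrow> 'x pmf) \<Rightarrow> real^'n \<Rightarrow> real^'n^'n" where
  "fisher_information F \<theta> =
     (\<chi> a b. measure_pmf.expectation (F \<theta>) (\<lambda>x. score F \<theta> a x * score F \<theta> b x))"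

subsection \<open>The layered detector\<close>

text \<open>A parameter vector \<open>\<theta> :: real^2\<close> has the components \<open>\<theta> $ 1 = p\<close> and \<open>\<theta> $ 2 = \<lambda>\<close>;
  layers are numbered from \<open>1\<close> to \<open>k\<close> and rounds from \<open>1\<close> to \<open>n\<close>.\<close>

definition layer_mean :: "real \<Rightarrow> nat \<Rightarrow> real^2 \<Rightarrow> real" where
  "layer_mean t i \<theta> = \<theta>$1 * (1 - \<theta>$1) ^ (i - 1) * \<theta>$2 * t"

definition total_information :: "nat \<Rightarrow> real \<Rightarrow> real^2 \<Rightarrow> real^2^2" where
  "total_information k t \<theta> =
     (\<Sum>i=1..k. fisher_information (\<lambda>\<theta>'. poisson_pmf (layer_mean t i \<theta>')) \<theta>)"

definition mean_count :: "nat \<Rightarrow> nat \<Rightarrow> (nat \<Rightarrow> nat \<Rightarrow> nat) \<Rightarrow> real" where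
  "mean_count k n x = (1 / real n) * (\<Sum>j=1..n. \<Sum>i=1..k. real (x i j))"

definition mean_weighted_count :: "nat \<Rightarrow> nat \<Rightarrow> (nat \<Rightarrow> nat \<Rightarrow> nat) \<Rightarrow> real" where
  "mean_weighted_count k n x = (1 / real n) * (\<Sum>j=1..n. \<Sum>i=1..k. (real i - 1) * real (x i j))"

definition log_likelihood :: "nat \<Rightarrow> real \<Rightarrow> nat \<Rightarrow> (nat \<Rightarrow> nat \<Rightarrow> nat) \<Rightarrow> real^2 \<Rightarrow> real" where
  "log_likelihood k t n x \<theta> = (\<Sum>j=1..n. \<Sum>i=1..k.
     - layer_mean t i \<theta> + real (x i j) * ln (layer_mean t i \<theta>) - ln (fact (x i j)))"

definition lambda_score :: "nat \<Rightarrow> real \<Rightarrow> nat \<Rightarrow> (nat \<Rightarrow> nat \<Rightarrow> nat) \<Rightarrow> real^2 \<Rightarrow> real" where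
  "lambda_score k t n x \<theta> =
     (let p = \<theta>$1; l = \<theta>$2; s = mean_count k n x
      in (s - l * t * (1 - (1 - p) ^ k)) / l)"

definition p_score :: "nat \<Rightarrow> real \<Rightarrow> nat \<Rightarrow> (nat \<Rightarrow> nat \<Rightarrow> nat) \<Rightarrow> real^2 \<Rightarrow> real" where
  "p_score k t n x \<theta> =
     (let p = \<theta>$1; l = \<theta>$2; s = mean_count k n x; z = mean_weighted_count k n x
      in ((1 - p) * (s + z) - z - l * t * (real k * (1 - p) ^ k - real k * (1 - p) ^ (k + 1)))
           / (p * (1 - p)))"

definition score_solutions :: "nat \<Rightarrow> real \<Rightarrow> nat \<Rightarrow> (nat \<Rightarrow> nat \<Rightarrow> nat) \<Rightarrow> (real^2) set" where
  "score_solutions k t n x =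
     {\<theta>. 0 < \<theta>$1 \<and> \<theta>$1 < 1 \<and> 0 < \<theta>$2 \<and> lambda_score k t n x \<theta> = 0 \<and> p_score k t n x \<theta> = 0}"

text \<open>Where the score equations do not have exactly one solution, the value of the estimator
  is only constrained to be measurable and to lie in \<open>[0,1] \<times> [0,\<infinity>)\<close>.\<close>

definition is_mle :: "'a measure \<Rightarrow> nat \<Rightarrow> real \<Rightarrow> (nat \<Rightarrow> nat \<Rightarrow> 'a \<Rightarrow> nat) \<Rightarrow> nat \<Rightarrow>
    ('a \<Rightarrow> real^2) \<Rightarrow> bool" where
  "is_mle M k t X n est \<longleftrightarrow>
     est \<in> borel_measurable M \<and>
     (\<forall>\<omega>\<in>space M. 0 \<le> est \<omega> $ 1 \<and> est \<omega> $ 1 \<le> 1 \<and> 0 \<le> est \<omega> $ 2) \<and>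
     (\<forall>\<omega>\<in>space M. \<forall>\<theta>. score_solutions k t n (\<lambda>i j. X i j \<omega>) = {\<theta>} \<longrightarrow> est \<omega> = \<theta>)"

text \<open>The two scores are the partial derivatives of the log-likelihood, divided by \<open>n\<close>.\<close>

lemma log_likelihood_deriv_lambda:
  fixes p l t :: real
  assumes "0 < p" "p < 1" "0 < l" "0 < t" "0 < n"
  shows "((\<lambda>l. log_likelihood k t n x (vector [p, l])) has_real_derivative
           real n * lambda_score k t n x (vector [p, l])) (at l)"
proof -
  have geo: "(\<Sum>i=1..k. p * (1 - p) ^ (i - 1)) = 1 - (1 - p) ^ k"
    by (induction k) (auto simp: algebra_simps)
  have "((\<lambda>l. log_likelihood k t n x (vector [p, l])) has_real_derivative
      (\<Sum>j=1..n. \<Sum>i=1..k. - (p * (1 - p) ^ (i - 1) * t) + real (x i j) / l)) (at l)"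
    unfolding log_likelihood_def layer_mean_def vector_2
    using assms by (auto intro!: derivative_eq_intros sum.cong simp: field_simps)
  also have "(\<Sum>j=1..n. \<Sum>i=1..k. - (p * (1 - p) ^ (i - 1) * t) + real (x i j) / l)
      = (\<Sum>j=1..n. \<Sum>i=1..k. real (x i j)) / l
        - real n * (t * (\<Sum>i=1..k. p * (1 - p) ^ (i - 1)))"
    by (simp add: sum.distrib sum_negf sum_subtractf flip: sum_divide_distrib sum_distrib_left sum_distrib_right)
  also have "\<dots> = real n * lambda_score k t n x (vector [p, l])"
    using assms unfolding lambda_score_def mean_count_def geo vector_2 Let_def
    by (simp add: field_simps)
  finally show ?thesis .
qed

lemma log_likelihood_deriv_p:
  fixes p l t :: real
  assumes "0 < p" "p < 1" "0 < l" "0 < t" "0 < n"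
  shows "((\<lambda>p. log_likelihood k t n x (vector [p, l])) has_real_derivative
           real n * p_score k t n x (vector [p, l])) (at p)"
proof -
  define c where "c i = (1 - p) ^ (i - 1) - p * (real (i - 1) * (1 - p) ^ (i - 1 - 1))" for i :: nat
  have sc: "(\<Sum>i=1..k. c i) = real k * (1 - p) ^ (k - 1)"
  proof (induction k)
    case (Suc k)
    then show ?case
      by (cases k) (auto simp: c_def algebra_simps)
  qed simp
  have cr: "real i - 1 = real (i - 1)" if "i \<in> {1..k}" for i
    using that by auto
  have pw: "real m * (1 - p) ^ (m - 1) = real m * (1 - p) ^ m / (1 - p)" for m
    using assms by (cases m) auto
  have "((\<lambda>p. layer_mean t i (vector [p, l])) has_real_derivative c i * l * t) (at p)" for i
    unfolding layer_mean_def vector_2 c_def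
    by (auto intro!: derivative_eq_intros simp: algebra_simps)
  note d = this
  have pos: "layer_mean t i (vector [p, l]) > 0" for i
    using assms by (simp add: layer_mean_def)
  have q: "c i * l * t / layer_mean t i (vector [p, l]) = 1 / p - real (i - 1) / (1 - p)" for i
    unfolding c_def layer_mean_def vector_2 pw using assms by (simp add: field_simps)
  have "((\<lambda>p. log_likelihood k t n x (vector [p, l])) has_real_derivative
      (\<Sum>j=1..n. \<Sum>i=1..k. - (c i * l * t) + real (x i j) *
         (c i * l * t / layer_mean t i (vector [p, l])))) (at p)"
    unfolding log_likelihood_def
    using pos by (auto intro!: derivative_eq_intros d sum.cong simp: field_simps)
  also have "(\<Sum>j=1..n. \<Sum>i=1..k. - (c i * l * t) + real (x i j) *
         (c i * l * t / layer_mean t i (vector [p, l])))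
      = (\<Sum>j=1..n. \<Sum>i=1..k. real (x i j)) / p
        - (\<Sum>j=1..n. \<Sum>i=1..k. (real i - 1) * real (x i j)) / (1 - p)
        - real n * (l * t * (\<Sum>i=1..k. c i))"
  proof -
    have "(\<Sum>i=1..k. - (c i * l * t) + real (x i j) * (1 / p - real (i - 1) / (1 - p)))
        = (\<Sum>i=1..k. real (x i j)) / p - (\<Sum>i=1..k. (real i - 1) * real (x i j)) / (1 - p)
          - l * t * (\<Sum>i=1..k. c i)" for j
      unfolding sum_divide_distrib sum_distrib_left sum_subtractf[symmetric]
      by (rule sum.cong) (simp_all only: cr, simp add: algebra_simps)
    then show ?thesis
      unfolding q by (simp only: sum_subtractf sum_divide_distrib[symmetric]) simp
  qed
  also have "\<dots> = real n * p_score k t n x (vector [p, l])"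
  proof -
    have fin: "S / p - Z / (1 - p) - real n * (l * t * (real k * (1 - p) ^ k / (1 - p)))
        = real n * (((1 - p) * (1 / real n * S + 1 / real n * Z) - 1 / real n * Z
            - l * t * (real k * (1 - p) ^ k - real k * (1 - p) ^ (k + 1))) / (p * (1 - p)))" for S Z
      using assms by (simp add: divide_simps) (simp add: algebra_simps)
    show ?thesis
      unfolding p_score_def mean_count_def mean_weighted_count_def sc vector_2 Let_def pw
      by (rule fin)
  qed
  finally show ?thesis .
qed

end

theory Submission
  imports Defs
begin

text \<open>The score equations say that the expected totals \<open>\<Sum>\<^sub>i m\<^sub>i\<close> and \<open>\<Sum>\<^sub>i (i - 1) m\<^sub>i\<close> equal the observed
  averages \<open>s\<^sub>n\<close> and \<open>z\<^sub>n\<close>. The map \<open>F\<close> from the parameters to the expected totals is injective with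
  invertible derivative, hence has an open image by invariance of domain and a differentiable inverse,
  and the estimator is \<open>F\<^sup>-\<^sup>1(s\<^sub>n, z\<^sub>n)\<close> as soon as \<open>(s\<^sub>n, z\<^sub>n)\<close> lies in the image. Consistency follows
  from the strong law of large numbers in each layer. The layers are independent, so the
  one-dimensional central limit theorem in each layer, realised by pointwise convergence on a product
  space, and the differentiability of \<open>F\<^sup>-\<^sup>1\<close> give the limit law of the estimator as that of a fixed
  linear combination \<open>\<Sum>\<^sub>i Z\<^sub>i w\<^sub>i\<close> of independent standard normal variables.\<close>

subsection \<open>Linear combinations of independent standard normal variables\<close>

text \<open>The inverse Fisher information \<open>I\<^sup>-\<^sup>1\<close> appears because
  \<open>ln m\<^sub>i\<close> is linear in the weight vector \<open>(1, i - 1)\<close>, so the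
  gradient \<open>u\<^sub>i\<close> of \<open>ln m\<^sub>i\<close> is the image of that vector under
  one linear map \<open>C\<close>. Composing \<open>C\<close> with the derivative of
  \<open>F\<close> gives \<open>I\<close>. Hence the inverse map has derivative
  \<open>I\<^sup>-\<^sup>1 C\<close>, and \<open>w\<^sub>i\<close> is \<open>sqrt m\<^sub>i\<close>
  times \<open>I\<^sup>-\<^sup>1 u\<^sub>i\<close>; the matrix \<open>I\<close> is never inverted
  explicitly. The normal law is given by a density, which exists only once two of the
  \<open>w\<^sub>i\<close> span the plane. The Gaussian computation therefore starts from two
  independent vectors and adds the others one at a time. It is carried out on pairs, where integrals
  can be iterated; \<open>a\<close>, \<open>b\<close>, \<open>c\<close> are the entries of the
  covariance matrix with rows \<open>(a, b)\<close> and \<open>(b, c)\<close>, and the exponent is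
  written with its adjugate. Where the score equations do not have a unique solution the estimator
  is arbitrary. Almost surely this happens for finitely many rounds only, which neither the almost
  sure limit nor a bounded test function notices.\<close>

definition bivariate_normal_density :: "real \<Rightarrow> real \<Rightarrow> real \<Rightarrow> real \<times> real \<Rightarrow> real" where
  "bivariate_normal_density a b c = (\<lambda>(x, y).
     exp (- (c * x\<^sup>2 - 2 * b * x * y + a * y\<^sup>2) / (2 * (a * c - b\<^sup>2))) / (2 * pi * sqrt (a * c - b\<^sup>2)))"

lemma bivariate_normal_density_measurable [measurable]:
  "bivariate_normal_density a b c \<in> borel_measurable borel"
  unfolding bivariate_normal_density_def borel_prod[symmetric] by measurable

lemma bivariate_normal_density_nonneg:
  "0 \<le> a * c - b\<^sup>2 \<Longrightarrow> 0 \<le> bivariate_normal_density a b c w"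
  by (cases w) (simp add: bivariate_normal_density_def)

text \<open>Completing the square in \<open>z\<close>; the cross terms vanish by Lagrange's identity
  \<open>q (x, y) * q (u, v) = D * (v x - u y)\<^sup>2 + B\<^sup>2\<close>, where \<open>q\<close> is the quadratic form in the exponent
  and \<open>B\<close> its polar form.\<close>

lemma bivariate_normal_density_shift:
  fixes a b c u v x y z :: real
  assumes D: "0 < a * c - b\<^sup>2" and D': "0 < (a + u\<^sup>2) * (c + v\<^sup>2) - (b + u * v)\<^sup>2"
  defines "D \<equiv> a * c - b\<^sup>2" and "D' \<equiv> (a + u\<^sup>2) * (c + v\<^sup>2) - (b + u * v)\<^sup>2"
  defines "B \<equiv> c * u * x - b * (u * y + v * x) + a * v * y"
  shows "bivariate_normal_density a b c (x - z * u, y - z * v) * std_normal_density z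
    = bivariate_normal_density (a + u\<^sup>2) (b + u * v) (c + v\<^sup>2) (x, y) * normal_density (B / D') (sqrt (D / D')) z"
proof -
  have pos: "0 < D" "0 < D'" using assms by auto
  define q where "q = c * x\<^sup>2 - 2 * b * x * y + a * y\<^sup>2"
  define r where "r = c * u\<^sup>2 - 2 * b * u * v + a * v\<^sup>2"
  define q' where "q' = (c + v\<^sup>2) * x\<^sup>2 - 2 * (b + u * v) * x * y + (a + u\<^sup>2) * y\<^sup>2"
  define qz where "qz = c * (x - z * u)\<^sup>2 - 2 * b * (x - z * u) * (y - z * v) + a * (y - z * v)\<^sup>2"
  have D'_eq: "D' = D + r"
    unfolding D'_def D_def r_def by (simp add: algebra_simps power2_eq_square)
  have qz: "qz = q - 2 * z * B + z\<^sup>2 * r"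
    unfolding qz_def q_def B_def r_def by (simp add: algebra_simps power2_eq_square)
  have lag: "q * D' = q' * D + B\<^sup>2"
    unfolding q_def q'_def D_def D'_def B_def by (simp add: algebra_simps power2_eq_square)
  have "qz / D + z\<^sup>2 = (qz + z\<^sup>2 * D) * D' / (D * D')"
    using pos by (simp add: field_simps)
  also have "(qz + z\<^sup>2 * D) * D' = q' * D + (z * D' - B)\<^sup>2"
  proof -
    have "(qz + z\<^sup>2 * D) * D' = q * D' - 2 * z * B * D' + z\<^sup>2 * D' * D'"
      by (simp add: qz D'_eq algebra_simps)
    also have "\<dots> = q' * D + (z * D' - B)\<^sup>2"
      using lag by algebra
    finally show ?thesis .
  qed
  also have "(q' * D + (z * D' - B)\<^sup>2) / (D * D') = q' / D' + (z - B / D')\<^sup>2 / (D / D')"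
  proof -
    have "z * D' - B = D' * (z - B / D')"
      using pos by (simp add: field_simps)
    then have "(z * D' - B)\<^sup>2 = D' * D' * (z - B / D')\<^sup>2"
      by (simp add: power2_eq_square)
    then show ?thesis
      using pos by (simp add: add_divide_distrib)
  qed
  finally have "- (qz / D + z\<^sup>2) / 2 = - (q' / D' + (z - B / D')\<^sup>2 / (D / D')) / 2"
    by (simp only:)
  moreover have "- (x / y + z) / 2 = - x / (2 * y) + - z / 2" for x y z :: real
    by (cases "y = 0") (auto simp: field_simps)
  moreover have "- (x / y + z / w) / 2 = - x / (2 * y) + - z / (2 * w)" for x y z w :: real
    by (cases "y = 0"; cases "w = 0") (auto simp: field_simps)
  ultimately have expo: "- qz / (2 * D) + - z\<^sup>2 / 2 = - q' / (2 * D') + - (z - B / D')\<^sup>2 / (2 * (D / D'))"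
    by (simp only:)
  have sq: "sqrt D' * sqrt (2 * pi * (D / D')) = sqrt D * sqrt (2 * pi)"
    using pos by (simp add: real_sqrt_mult[symmetric])
  have s2: "(sqrt (D / D'))\<^sup>2 = D / D'"
    using pos by simp
  have "bivariate_normal_density a b c (x - z * u, y - z * v) * std_normal_density z
      = exp (- qz / (2 * D) + - z\<^sup>2 / 2) / (2 * pi * (sqrt D * sqrt (2 * pi)))"
    unfolding bivariate_normal_density_def normal_density_def exp_add prod.case D_def[symmetric] qz_def[symmetric]
    by simp
  also have "\<dots> = exp (- q' / (2 * D')) * exp (- (z - B / D')\<^sup>2 / (2 * (D / D'))) /
      (2 * pi * (sqrt D' * sqrt (2 * pi * (D / D'))))"
    unfolding expo sq exp_add ..
  also have "\<dots> = bivariate_normal_density (a + u\<^sup>2) (b + u * v) (c + v\<^sup>2) (x, y) *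
      normal_density (B / D') (sqrt (D / D')) z"
    unfolding bivariate_normal_density_def normal_density_def prod.case D'_def[symmetric] q'_def[symmetric] s2
    by simp
  finally show ?thesis .
qed

text \<open>Adding an independent normal multiple of \<open>(u, v)\<close> adds a rank-one matrix to
  the covariance. By the matrix determinant lemma the determinant grows by the adjugate form at
  \<open>(u, v)\<close>, which is nonnegative by completing the square after multiplication by
  \<open>a\<close>.\<close>

lemma covariance_det_step:
  fixes a b c u v :: real
  assumes "0 \<le> a" "0 \<le> c" "0 < a * c - b\<^sup>2"
  shows "0 < (a + u\<^sup>2) * (c + v\<^sup>2) - (b + u * v)\<^sup>2"
proof -
  have ac: "0 < a * c"
    using assms(3) zero_le_power2[of b] by linarith
  then have "0 < a"
    using assms(1) by (cases "a = 0") auto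
  have "0 \<le> (a * v - b * u)\<^sup>2 + (a * c - b\<^sup>2) * u\<^sup>2"
    using assms by (intro add_nonneg_nonneg mult_nonneg_nonneg) auto
  also have "\<dots> = a * (c * u\<^sup>2 - 2 * b * u * v + a * v\<^sup>2)"
    by (simp add: algebra_simps power2_eq_square)
  finally have "0 \<le> c * u\<^sup>2 - 2 * b * u * v + a * v\<^sup>2"
    using \<open>0 < a\<close> by (simp add: zero_le_mult_iff)
  moreover have "(a + u\<^sup>2) * (c + v\<^sup>2) - (b + u * v)\<^sup>2 = (a * c - b\<^sup>2) + (c * u\<^sup>2 - 2 * b * u * v + a * v\<^sup>2)"
    by (simp add: algebra_simps power2_eq_square)
  ultimately show ?thesis using assms by linarith
qed

lemma nn_integral_lborel_shift:
  fixes f :: "'a::euclidean_space \<Rightarrow> ennreal"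
  assumes [measurable]: "f \<in> borel_measurable borel"
  shows "(\<integral>\<^sup>+x. f (x + t) \<partial>lborel) = (\<integral>\<^sup>+x. f x \<partial>lborel)"
proof -
  have "(\<integral>\<^sup>+x. f x \<partial>lborel) = (\<integral>\<^sup>+x. f x \<partial>distr lborel borel ((+) t))"
    by (simp add: lborel_distr_plus)
  also have "\<dots> = (\<integral>\<^sup>+x. f (x + t) \<partial>lborel)"
    by (subst nn_integral_distr) (auto simp: add.commute)
  finally show ?thesis by simp
qed

text \<open>Translation invariance moves the shift from \<open>f\<close> into the density. After
  exchanging the integrals, the shift identity splits off a normal density in \<open>z\<close>,
  which integrates to one.\<close>

lemma nn_integral_bivariate_normal_add:
  fixes f :: "real \<times> real \<Rightarrow> ennreal"
  assumes [measurable]: "f \<in> borel_measurable borel"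
    and "0 \<le> a" "0 \<le> c" and D: "0 < a * c - b\<^sup>2"
  shows "(\<integral>\<^sup>+z. (\<integral>\<^sup>+w. f (w + z *\<^sub>R (u, v)) * bivariate_normal_density a b c w \<partial>lborel) * std_normal_density z \<partial>lborel)
    = (\<integral>\<^sup>+w. f w * bivariate_normal_density (a + u\<^sup>2) (b + u * v) (c + v\<^sup>2) w \<partial>lborel)"
proof -
  note D' = covariance_det_step[OF assms(2,3) D, of u v]
  let ?g = "bivariate_normal_density a b c"
  let ?g' = "bivariate_normal_density (a + u\<^sup>2) (b + u * v) (c + v\<^sup>2)"
  have "(\<integral>\<^sup>+z. (\<integral>\<^sup>+w. f (w + z *\<^sub>R (u, v)) * ?g w \<partial>lborel) * std_normal_density z \<partial>lborel)
      = (\<integral>\<^sup>+z. (\<integral>\<^sup>+w. f w * ?g (w - z *\<^sub>R (u, v)) \<partial>lborel) * std_normal_density z \<partial>lborel)"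
  proof -
    have "(\<integral>\<^sup>+w. f (w + z *\<^sub>R (u, v)) * ?g w \<partial>lborel) = (\<integral>\<^sup>+w. f w * ?g (w - z *\<^sub>R (u, v)) \<partial>lborel)" for z
      by (subst nn_integral_lborel_shift[symmetric, where t = "z *\<^sub>R (u, v)"]) (simp_all)
    then show ?thesis by simp
  qed
  also have "\<dots> = (\<integral>\<^sup>+z. (\<integral>\<^sup>+w. f w * ?g (w - z *\<^sub>R (u, v)) * std_normal_density z \<partial>lborel) \<partial>lborel)"
    by (intro nn_integral_cong) (simp add: nn_integral_multc)
  also have "\<dots> = (\<integral>\<^sup>+w. (\<integral>\<^sup>+z. f w * ?g (w - z *\<^sub>R (u, v)) * std_normal_density z \<partial>lborel) \<partial>lborel)"
    by (rule lborel_pair.Fubini') measurable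
  also have "\<dots> = (\<integral>\<^sup>+w. f w * ?g' w \<partial>lborel)"
  proof (intro nn_integral_cong)
    fix w :: "real \<times> real"
    obtain x y where w: "w = (x, y)" by (cases w)
    define B where "B = c * u * x - b * (u * y + v * x) + a * v * y"
    define s where "s = (a * c - b\<^sup>2) / ((a + u\<^sup>2) * (c + v\<^sup>2) - (b + u * v)\<^sup>2)"
    define \<mu> where "\<mu> = B / ((a + u\<^sup>2) * (c + v\<^sup>2) - (b + u * v)\<^sup>2)"
    have s: "0 < sqrt s" using D D' by (simp add: s_def)
    have "(\<integral>\<^sup>+z. f w * ?g (w - z *\<^sub>R (u, v)) * std_normal_density z \<partial>lborel)
        = (\<integral>\<^sup>+z. f w * ?g' w * ennreal (normal_density \<mu> (sqrt s) z) \<partial>lborel)"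
      using bivariate_normal_density_shift[OF D D', of x _ y] D D'
      by (intro nn_integral_cong)
        (simp add: w mult.assoc ennreal_mult'[symmetric] ennreal_mult''[symmetric] bivariate_normal_density_nonneg \<mu>_def s_def B_def)
    also have "\<dots> = f w * ?g' w * (\<integral>\<^sup>+z. ennreal (normal_density \<mu> (sqrt s) z) \<partial>lborel)"
      by (simp add: nn_integral_cmult)
    also have "(\<integral>\<^sup>+z. ennreal (normal_density \<mu> (sqrt s) z) \<partial>lborel) = 1"
      using s integral_normal_density[OF s, of \<mu>] integrable_normal_density[OF s, of \<mu>]
      by (subst nn_integral_eq_integral) auto
    finally show "(\<integral>\<^sup>+z. f w * ?g (w - z *\<^sub>R (u, v)) * std_normal_density z \<partial>lborel) = f w * ?g' w"
      by simp
  qed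
  finally show ?thesis .
qed

text \<open>The linear change of variables is done one coordinate at a time. For fixed
  \<open>x\<close> the substitution \<open>y = v1 * x / u1 + ?D / u1 * z\<close> contributes
  \<open>\<bar>?D / u1\<bar>\<close>. For fixed \<open>z\<close> the substitution
  \<open>x = z * u2 + u1 * x'\<close> contributes \<open>\<bar>u1\<bar>\<close>. The product is the
  Jacobian \<open>\<bar>?D\<bar>\<close>; the divisions are the reason for
  \<open>u1 \<noteq> 0\<close>.\<close>

lemma nn_integral_two_std_normals_aux:
  fixes f :: "real \<times> real \<Rightarrow> ennreal"
  assumes [measurable]: "f \<in> borel_measurable borel"
    and D: "u1 * v2 - u2 * v1 \<noteq> (0 :: real)" and u1: "u1 \<noteq> 0"
  shows "(\<integral>\<^sup>+z2. (\<integral>\<^sup>+z1. f (z1 *\<^sub>R (u1, v1) + z2 *\<^sub>R (u2, v2)) * std_normal_density z1 * std_normal_density z2 \<partial>lborel) \<partial>lborel)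
    = (\<integral>\<^sup>+w. f w * bivariate_normal_density (u1\<^sup>2 + u2\<^sup>2) (u1 * v1 + u2 * v2) (v1\<^sup>2 + v2\<^sup>2) w \<partial>lborel)"
proof -
  let ?D = "u1 * v2 - u2 * v1"
  let ?g = "bivariate_normal_density (u1\<^sup>2 + u2\<^sup>2) (u1 * v1 + u2 * v2) (v1\<^sup>2 + v2\<^sup>2)"
  define h where "h w = f w * ennreal (?g w)" for w
  have [measurable]: "h \<in> borel_measurable borel"
    unfolding h_def by measurable
  have [measurable]: "(\<lambda>p. h (fst p, snd p)) \<in> borel_measurable (borel \<Otimes>\<^sub>M borel)"
    unfolding borel_prod by simp
  have hm [measurable]: "(\<lambda>x. h (p x, q x)) \<in> borel_measurable N"
    if [measurable]: "p \<in> borel_measurable N" "q \<in> borel_measurable N" for p q :: "'b \<Rightarrow> real" and N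
  proof -
    have "(\<lambda>x. (p x, q x)) \<in> measurable N borel"
      unfolding borel_prod[symmetric] by measurable
    then show ?thesis by measurable
  qed
  have det: "(u1\<^sup>2 + u2\<^sup>2) * (v1\<^sup>2 + v2\<^sup>2) - (u1 * v1 + u2 * v2)\<^sup>2 = ?D\<^sup>2"
    by (simp add: algebra_simps power2_eq_square)
  have "(\<integral>\<^sup>+w. h w \<partial>lborel) = (\<integral>\<^sup>+x. \<integral>\<^sup>+y. h (x, y) \<partial>lborel \<partial>lborel)"
    unfolding lborel_prod[symmetric] by (subst lborel.nn_integral_fst[symmetric]) (auto simp: lborel_prod)
  also have "\<dots> = (\<integral>\<^sup>+x. ennreal \<bar>?D / u1\<bar> * (\<integral>\<^sup>+z. h (x, v1 * x / u1 + ?D / u1 * z) \<partial>lborel) \<partial>lborel)"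
    using D u1 by (intro nn_integral_cong nn_integral_real_affine) auto
  also have "\<dots> = ennreal \<bar>?D / u1\<bar> * (\<integral>\<^sup>+x. (\<integral>\<^sup>+z. h (x, v1 * x / u1 + ?D / u1 * z) \<partial>lborel) \<partial>lborel)"
    by (rule nn_integral_cmult) measurable
  also have "(\<integral>\<^sup>+x. (\<integral>\<^sup>+z. h (x, v1 * x / u1 + ?D / u1 * z) \<partial>lborel) \<partial>lborel)
      = (\<integral>\<^sup>+z. (\<integral>\<^sup>+x. h (x, v1 * x / u1 + ?D / u1 * z) \<partial>lborel) \<partial>lborel)"
    by (rule lborel_pair.Fubini'[symmetric]) measurable
  also have "\<dots> = (\<integral>\<^sup>+z. ennreal \<bar>u1\<bar> * (\<integral>\<^sup>+x. h (z * u2 + u1 * x, v1 * (z * u2 + u1 * x) / u1 + ?D / u1 * z) \<partial>lborel) \<partial>lborel)"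
    using u1 by (intro nn_integral_cong nn_integral_real_affine) auto
  also have "\<dots> = ennreal \<bar>u1\<bar> * (\<integral>\<^sup>+z. (\<integral>\<^sup>+x. h (z * u2 + u1 * x, v1 * (z * u2 + u1 * x) / u1 + ?D / u1 * z) \<partial>lborel) \<partial>lborel)"
    by (rule nn_integral_cmult) measurable
  also have "ennreal \<bar>?D / u1\<bar> * (ennreal \<bar>u1\<bar> * (\<integral>\<^sup>+z. (\<integral>\<^sup>+x. h (z * u2 + u1 * x, v1 * (z * u2 + u1 * x) / u1 + ?D / u1 * z) \<partial>lborel) \<partial>lborel))
      = ennreal \<bar>?D\<bar> * (\<integral>\<^sup>+z. (\<integral>\<^sup>+x. h (x *\<^sub>R (u1, v1) + z *\<^sub>R (u2, v2)) \<partial>lborel) \<partial>lborel)"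
  proof -
    have "(z * u2 + u1 * x, v1 * (z * u2 + u1 * x) / u1 + ?D / u1 * z) = x *\<^sub>R (u1, v1) + z *\<^sub>R (u2, v2)" for x z
      using u1 by (simp add: field_simps)
    moreover have "ennreal \<bar>?D / u1\<bar> * ennreal \<bar>u1\<bar> = ennreal \<bar>?D\<bar>"
      using u1 by (simp add: ennreal_mult'[symmetric])
    ultimately show ?thesis by (simp only: mult.assoc[symmetric])
  qed
  also have "\<dots> = (\<integral>\<^sup>+z. (\<integral>\<^sup>+x. ennreal \<bar>?D\<bar> * h (x *\<^sub>R (u1, v1) + z *\<^sub>R (u2, v2)) \<partial>lborel) \<partial>lborel)"
    by (simp add: nn_integral_cmult)
  also have "\<dots> = (\<integral>\<^sup>+z2. (\<integral>\<^sup>+z1. f (z1 *\<^sub>R (u1, v1) + z2 *\<^sub>R (u2, v2)) * std_normal_density z1 * std_normal_density z2 \<partial>lborel) \<partial>lborel)"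
  proof (intro nn_integral_cong)
    fix z x :: real
    let ?w = "x *\<^sub>R (u1, v1) + z *\<^sub>R (u2, v2)"
    \<comment> \<open>With \<open>W\<close> the matrix whose columns are the two vectors, the
      covariance is \<open>W\<close> times its transpose. Its inverse form at
      \<open>W (x, z)\<close> is therefore \<open>x\<^sup>2 + z\<^sup>2\<close>; the adjugate form
      is this times the determinant \<open>?D\<^sup>2\<close>.\<close>
    have e: "(v1\<^sup>2 + v2\<^sup>2) * (x * u1 + z * u2)\<^sup>2 - 2 * (u1 * v1 + u2 * v2) * (x * u1 + z * u2) * (x * v1 + z * v2)
        + (u1\<^sup>2 + u2\<^sup>2) * (x * v1 + z * v2)\<^sup>2 = ?D\<^sup>2 * (x\<^sup>2 + z\<^sup>2)"
      by (simp add: algebra_simps power2_eq_square)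
    have "\<bar>?D\<bar> * ?g ?w = exp (- (?D\<^sup>2 * (x\<^sup>2 + z\<^sup>2)) / (2 * ?D\<^sup>2)) / (2 * pi)"
    proof -
      have "?w = (x * u1 + z * u2, x * v1 + z * v2)" by simp
      then show ?thesis
        using D by (simp only: bivariate_normal_density_def det e prod.case) simp
    qed
    also have "- (?D\<^sup>2 * (x\<^sup>2 + z\<^sup>2)) / (2 * ?D\<^sup>2) = - x\<^sup>2 / 2 + - z\<^sup>2 / 2"
      using D by (simp add: field_simps)
    also have "exp (- x\<^sup>2 / 2 + - z\<^sup>2 / 2) / (2 * pi) = std_normal_density x * std_normal_density z"
      unfolding exp_add by (simp add: normal_density_def)
    finally have "\<bar>?D\<bar> * ?g ?w = std_normal_density x * std_normal_density z" .
    moreover have "0 \<le> ?g ?w"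
      by (rule bivariate_normal_density_nonneg) (simp add: det)
    ultimately have "ennreal \<bar>?D\<bar> * ennreal (?g ?w) = ennreal (std_normal_density x) * ennreal (std_normal_density z)"
      by (metis abs_ge_zero ennreal_mult normal_density_nonneg)
    moreover have "ennreal \<bar>?D\<bar> * h ?w = f ?w * (ennreal \<bar>?D\<bar> * ennreal (?g ?w))"
      unfolding h_def by (rule mult.left_commute)
    ultimately show "ennreal \<bar>?D\<bar> * h ?w = f ?w * std_normal_density x * std_normal_density z"
      by (simp only: mult.assoc)
  qed
  finally show ?thesis by (simp add: h_def)
qed

lemma nn_integral_two_std_normals:
  fixes f :: "real \<times> real \<Rightarrow> ennreal"
  assumes [measurable]: "f \<in> borel_measurable borel"
    and D: "u1 * v2 - u2 * v1 \<noteq> (0 :: real)"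
  shows "(\<integral>\<^sup>+z2. (\<integral>\<^sup>+z1. f (z1 *\<^sub>R (u1, v1) + z2 *\<^sub>R (u2, v2)) * std_normal_density z1 * std_normal_density z2 \<partial>lborel) \<partial>lborel)
    = (\<integral>\<^sup>+w. f w * bivariate_normal_density (u1\<^sup>2 + u2\<^sup>2) (u1 * v1 + u2 * v2) (v1\<^sup>2 + v2\<^sup>2) w \<partial>lborel)"
proof (cases "u1 = 0")
  case False
  then show ?thesis using assms nn_integral_two_std_normals_aux by blast
next
  case True
  \<comment> \<open>The determinant is now \<open>- u2 * v1\<close>, so exchanging the two variables
    brings a nonzero first coordinate to the front.\<close>
  then have "u2 \<noteq> 0" using D by auto
  have [measurable]: "(\<lambda>(z1, z2). z1 *\<^sub>R (u1, v1) + z2 *\<^sub>R (u2, v2)) \<in> borel_measurable (borel \<Otimes>\<^sub>M borel)"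
    by measurable
  have "(\<integral>\<^sup>+z2. (\<integral>\<^sup>+z1. f (z1 *\<^sub>R (u1, v1) + z2 *\<^sub>R (u2, v2)) * std_normal_density z1 * std_normal_density z2 \<partial>lborel) \<partial>lborel)
     = (\<integral>\<^sup>+z1. (\<integral>\<^sup>+z2. f (z1 *\<^sub>R (u1, v1) + z2 *\<^sub>R (u2, v2)) * std_normal_density z1 * std_normal_density z2 \<partial>lborel) \<partial>lborel)"
    by (rule lborel_pair.Fubini') measurable
  also have "\<dots> = (\<integral>\<^sup>+z1. (\<integral>\<^sup>+z2. f (z2 *\<^sub>R (u2, v2) + z1 *\<^sub>R (u1, v1)) * std_normal_density z2 * std_normal_density z1 \<partial>lborel) \<partial>lborel)"
    by (simp add: mult_ac add.commute)
  also have "\<dots> = (\<integral>\<^sup>+w. f w * bivariate_normal_density (u2\<^sup>2 + u1\<^sup>2) (u2 * v2 + u1 * v1) (v2\<^sup>2 + v1\<^sup>2) w \<partial>lborel)"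
    using D \<open>u2 \<noteq> 0\<close> by (intro nn_integral_two_std_normals_aux) (auto simp: algebra_simps)
  finally show ?thesis by (simp add: add.commute)
qed

section \<open>Finite products of standard normal laws\<close>

lemma prob_space_std_normal: "prob_space (density lborel std_normal_density)"
  by (rule prob_space_normal_density) simp

text \<open>Strict Cauchy-Schwarz for two families that are not proportional. On
  \<open>{i, j}\<close> the Gram determinant is the square of the nonzero minor, and by
  \<open>covariance_det_step\<close> further indices keep it positive.\<close>

lemma covariance_det_pos:
  fixes u v :: "'i \<Rightarrow> real"
  assumes I: "finite I" "i \<in> I" "j \<in> I" and ij: "u i * v j - u j * v i \<noteq> 0"
  shows "0 < (\<Sum>l\<in>I. (u l)\<^sup>2) * (\<Sum>l\<in>I. (v l)\<^sup>2) - (\<Sum>l\<in>I. u l * v l)\<^sup>2"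
proof -
  have "i \<noteq> j" using ij by auto
  have "0 < (\<Sum>l\<in>K \<union> {i, j}. (u l)\<^sup>2) * (\<Sum>l\<in>K \<union> {i, j}. (v l)\<^sup>2) - (\<Sum>l\<in>K \<union> {i, j}. u l * v l)\<^sup>2"
    if "finite K" "i \<notin> K" "j \<notin> K" for K
    using that
  proof (induction K rule: finite_induct)
    case empty
    have "((u i)\<^sup>2 + (u j)\<^sup>2) * ((v i)\<^sup>2 + (v j)\<^sup>2) - (u i * v i + u j * v j)\<^sup>2 = (u i * v j - u j * v i)\<^sup>2"
      by (simp add: algebra_simps power2_eq_square)
    also have "\<dots> > 0"
      using ij by simp
    finally show ?case
      using \<open>i \<noteq> j\<close> by simp
  next
    case (insert m K)
    let ?I = "K \<union> {i, j}"
    have I: "finite ?I" "m \<notin> ?I" "insert m K \<union> {i, j} = insert m ?I"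
      using insert by auto
    have s: "(\<Sum>l\<in>insert m ?I. h l) = (\<Sum>l\<in>?I. h l) + h m" for h :: "'i \<Rightarrow> real"
      using sum.insert[OF I(1,2), of h] by simp
    have D: "0 < (\<Sum>l\<in>?I. (u l)\<^sup>2) * (\<Sum>l\<in>?I. (v l)\<^sup>2) - (\<Sum>l\<in>?I. u l * v l)\<^sup>2"
      using insert by auto
    show ?case
      unfolding I s by (intro covariance_det_step[OF _ _ D] sum_nonneg) auto
  qed
  from this[of "I - {i, j}"] I show ?thesis
    by (simp add: insert_absorb Un_commute)
qed

text \<open>The induction runs over the indices other than \<open>i\<close> and \<open>j\<close>,
  since the covariance must be nondegenerate from the start for a density to exist. Measurability of
  \<open>f\<close> is passed in as an induction premise because the hypothesis is applied to
  translates of \<open>f\<close>.\<close>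

lemma nn_integral_PiM_std_normals:
  fixes f :: "real \<times> real \<Rightarrow> ennreal" and u v :: "'i \<Rightarrow> real"
  assumes [measurable]: "f \<in> borel_measurable borel"
    and "finite K" "i \<notin> K" "j \<notin> K" "i \<noteq> j" "u i * v j - u j * v i \<noteq> 0"
  defines "I \<equiv> K \<union> {i, j}"
  shows "(\<integral>\<^sup>+z. f (\<Sum>l\<in>I. z l *\<^sub>R (u l, v l)) \<partial>PiM I (\<lambda>_. density lborel std_normal_density))
      = (\<integral>\<^sup>+w. f w * bivariate_normal_density (\<Sum>l\<in>I. (u l)\<^sup>2) (\<Sum>l\<in>I. u l * v l) (\<Sum>l\<in>I. (v l)\<^sup>2) w \<partial>lborel)"
  using assms(2,3,4) assms(1) unfolding I_def
proof (induction K arbitrary: f rule: finite_induct)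
  case empty
  interpret prob_space "density lborel std_normal_density" by (rule prob_space_std_normal)
  interpret product_sigma_finite "\<lambda>_::'i. density lborel std_normal_density" ..
  note [measurable] = empty(3)
  have ij: "{} \<union> {i, j} = insert i {j}" by auto
  have s: "(\<Sum>l\<in>insert i {j}. h l) = h i + h j" for h :: "'i \<Rightarrow> 'b::ab_group_add"
    using \<open>i \<noteq> j\<close> by simp
  have "(\<integral>\<^sup>+z. f (\<Sum>l\<in>insert i {j}. z l *\<^sub>R (u l, v l)) \<partial>PiM (insert i {j}) (\<lambda>_. density lborel std_normal_density))
     = (\<integral>\<^sup>+z. (\<integral>\<^sup>+y. f (y *\<^sub>R (u i, v i) + z j *\<^sub>R (u j, v j)) \<partial>density lborel std_normal_density) \<partial>PiM {j} (\<lambda>_. density lborel std_normal_density))"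
    using \<open>i \<noteq> j\<close> by (subst product_nn_integral_insert) (auto simp: s)
  also have "\<dots> = (\<integral>\<^sup>+z. (\<integral>\<^sup>+y. f (y *\<^sub>R (u i, v i) + z *\<^sub>R (u j, v j)) \<partial>density lborel std_normal_density) \<partial>density lborel std_normal_density)"
    by (subst product_nn_integral_singleton) auto
  also have "\<dots> = (\<integral>\<^sup>+z2. (\<integral>\<^sup>+z1. f (z1 *\<^sub>R (u i, v i) + z2 *\<^sub>R (u j, v j)) * std_normal_density z1 * std_normal_density z2 \<partial>lborel) \<partial>lborel)"
    by (simp add: nn_integral_density nn_integral_cmult[symmetric] mult_ac)
  also note nn_integral_two_std_normals[OF empty(3) assms(6)]
  finally show ?case
    unfolding ij s .
next
  case (insert m K)
  interpret prob_space "density lborel std_normal_density" by (rule prob_space_std_normal)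
  interpret product_sigma_finite "\<lambda>_::'i. density lborel std_normal_density" ..
  note [measurable] = insert.prems(3)
  let ?I = "K \<union> {i, j}"
  let ?P = "PiM ?I (\<lambda>_. density lborel (\<lambda>x. ennreal (std_normal_density x)))"
  interpret P: prob_space ?P
    by (intro prob_space_PiM prob_space_std_normal)
  interpret pair_sigma_finite ?P "density lborel std_normal_density" ..
  have I: "finite ?I" "m \<notin> ?I" "insert m K \<union> {i, j} = insert m ?I"
    using insert by auto
  have s: "(\<Sum>l\<in>insert m ?I. h l) = (\<Sum>l\<in>?I. h l) + h m" for h :: "'i \<Rightarrow> 'b::ab_group_add"
    using I by (simp add: add.commute)
  let ?a = "\<Sum>l\<in>?I. (u l)\<^sup>2" and ?b = "\<Sum>l\<in>?I. u l * v l" and ?c = "\<Sum>l\<in>?I. (v l)\<^sup>2"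
  have D: "0 < ?a * ?c - ?b\<^sup>2"
    using insert assms(6) by (intro covariance_det_pos) auto
  have "(\<Sum>l\<in>?I. (z(m := y)) l *\<^sub>R (u l, v l)) = (\<Sum>l\<in>?I. z l *\<^sub>R (u l, v l))" for z and y :: real
    using I by (intro sum.cong) auto
  then have "(\<integral>\<^sup>+z. f (\<Sum>l\<in>insert m ?I. z l *\<^sub>R (u l, v l)) \<partial>PiM (insert m ?I) (\<lambda>_. density lborel std_normal_density))
    = (\<integral>\<^sup>+z. (\<integral>\<^sup>+y. f ((\<Sum>l\<in>?I. z l *\<^sub>R (u l, v l)) + y *\<^sub>R (u m, v m)) \<partial>density lborel std_normal_density) \<partial>?P)"
    unfolding s using I by (subst product_nn_integral_insert) auto
  also have "\<dots> = (\<integral>\<^sup>+y. (\<integral>\<^sup>+z. f ((\<Sum>l\<in>?I. z l *\<^sub>R (u l, v l)) + y *\<^sub>R (u m, v m)) \<partial>?P) \<partial>density lborel std_normal_density)"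
    by (rule Fubini'[symmetric]) measurable
  also have "\<dots> = (\<integral>\<^sup>+y. (\<integral>\<^sup>+w. f (w + y *\<^sub>R (u m, v m)) * bivariate_normal_density ?a ?b ?c w \<partial>lborel) \<partial>density lborel std_normal_density)"
  proof (rule nn_integral_cong)
    fix y
    show "(\<integral>\<^sup>+z. f ((\<Sum>l\<in>?I. z l *\<^sub>R (u l, v l)) + y *\<^sub>R (u m, v m)) \<partial>?P)
      = (\<integral>\<^sup>+w. f (w + y *\<^sub>R (u m, v m)) * bivariate_normal_density ?a ?b ?c w \<partial>lborel)"
      using insert by (intro insert.IH) auto
  qed
  also have "\<dots> = (\<integral>\<^sup>+y. (\<integral>\<^sup>+w. f (w + y *\<^sub>R (u m, v m)) * bivariate_normal_density ?a ?b ?c w \<partial>lborel) * std_normal_density y \<partial>lborel)"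
    by (subst nn_integral_density) (auto simp: mult.commute)
  also have "\<dots> = (\<integral>\<^sup>+w. f w * bivariate_normal_density (?a + (u m)\<^sup>2) (?b + u m * v m) (?c + (v m)\<^sup>2) w \<partial>lborel)"
    using D by (intro nn_integral_bivariate_normal_add) (auto intro: sum_nonneg)
  finally show ?case
    unfolding I s .
qed

section \<open>Transfer from pairs to two-dimensional vectors\<close>

lemma vector_2_eq_axis: "(vector [x, y] :: real^2) = x *\<^sub>R axis 1 1 + y *\<^sub>R axis 2 1"
  by (simp add: vec_eq_iff forall_2 axis_def)

lemma borel_measurable_vector_2 [measurable]:
  "f \<in> borel_measurable M \<Longrightarrow> g \<in> borel_measurable M \<Longrightarrow> (\<lambda>x. vector [f x, g x] :: real^2) \<in> borel_measurable M"
  unfolding vector_2_eq_axis by (intro borel_measurable_add borel_measurable_scaleR) auto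

lemma borel_measurable_fst_snd [measurable]:
  "fst \<in> borel_measurable (borel :: ('a::second_countable_topology \<times> 'b::second_countable_topology) measure)"
  "snd \<in> borel_measurable (borel :: ('a \<times> 'b) measure)"
  by (intro borel_measurable_continuous_onI continuous_intros)+

text \<open>Carries the Gaussian integrals, computed on pairs, over to \<open>real^2\<close>.
  Lebesgue measure is determined by its values on boxes, and both measures assign a box the product
  of its side lengths.\<close>

lemma lborel_vec_2:
  "(lborel :: (real^2) measure) = distr lborel borel (\<lambda>w. vector [fst w, snd w] :: real^2)"
proof (rule lborel_eqI)
  fix l u :: "real^2" assume le: "\<And>b. b \<in> Basis \<Longrightarrow> l \<bullet> b \<le> u \<bullet> b"
  have B2: "(Basis :: (real^2) set) = {axis 1 1, axis 2 1}"
    unfolding Basis_vec_def by auto (metis exhaust_2)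
  have le': "l $ i \<le> u $ i" for i
    using le[of "axis i 1"] by (simp add: inner_axis)
  have "emeasure (distr lborel borel (\<lambda>w. vector [fst w, snd w] :: real^2)) (box l u)
      = emeasure lborel (box (l$1, l$2) (u$1, u$2))"
  proof -
    have "(\<lambda>w. vector [fst w, snd w] :: real^2) -` box l u \<inter> space lborel = box (l$1, l$2) (u$1, u$2)"
      by (auto simp: mem_box B2 inner_axis Basis_prod_def)
    then show ?thesis
      by (subst emeasure_distr) simp_all
  qed
  also have "\<dots> = ennreal ((u$1 - l$1) * (u$2 - l$2))"
    by (subst emeasure_lborel_box) (auto simp: Basis_prod_def le' inner_diff_left ennreal_mult' mult.commute)
  also have "(u$1 - l$1) * (u$2 - l$2) = (\<Prod>b\<in>Basis. (u - l) \<bullet> b)"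
    unfolding B2 by (simp add: axis_eq_axis inner_axis)
  finally show "emeasure (distr lborel borel (\<lambda>w. vector [fst w, snd w] :: real^2)) (box l u) = (\<Prod>b\<in>Basis. (u - l) \<bullet> b)" .
qed simp

text \<open>\<open>matrix_inv\<close> is a choice among two-sided inverses. For square matrices a
  right inverse is two-sided, and two-sided inverses are unique.\<close>

lemma matrix_inv_eqI:
  fixes A :: "real^'n^'n"
  assumes "A ** B = mat 1"
  shows "matrix_inv A = B"
proof -
  have "B ** A = mat 1"
    using assms by (simp add: matrix_left_right_inverse)
  then have "A ** matrix_inv A = mat 1"
    using assms unfolding matrix_inv_def by (metis (mono_tags, lifting) someI_ex)
  then have "B ** (A ** matrix_inv A) = B"
    by (simp add: matrix_mul_rid)
  then show ?thesis
    using \<open>B ** A = mat 1\<close> by (simp add: matrix_mul_assoc matrix_mul_lid)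
qed

lemma matrix_inv_2:
  fixes A :: "real^2^2"
  assumes "det A \<noteq> 0"
  shows "matrix_inv A = (1 / det A) *\<^sub>R vector [vector [A$2$2, - A$1$2], vector [- A$2$1, A$1$1]]"
proof (rule matrix_inv_eqI)
  define B :: "real^2^2" where "B = vector [vector [A$2$2, - A$1$2], vector [- A$2$1, A$1$1]]"
  have "A ** B = det A *\<^sub>R mat 1"
    unfolding B_def vec_eq_iff matrix_matrix_mult_def forall_2 mat_def det_2
    by (simp add: sum_2 algebra_simps)
  moreover have "A ** ((1 / det A) *\<^sub>R B) = (1 / det A) *\<^sub>R (A ** B)"
    by (simp add: vec_eq_iff matrix_matrix_mult_def sum_distrib_left algebra_simps)
  ultimately show "A ** ((1 / det A) *\<^sub>R vector [vector [A$2$2, - A$1$2], vector [- A$2$1, A$1$1]]) = mat 1"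
    using assms by (simp add: B_def)
qed

lemma multivariate_normal_2:
  fixes S :: "real^2^2"
  assumes "S$2$1 = S$1$2" "0 < det S"
  shows "multivariate_normal 0 S =
     density lborel (\<lambda>x. ennreal (bivariate_normal_density (S$1$1) (S$1$2) (S$2$2) (x$1, x$2)))"
proof -
  have d: "det S = S$1$1 * S$2$2 - (S$1$2)\<^sup>2"
    using assms by (simp add: det_2 power2_eq_square)
  have "x \<bullet> (matrix_inv S *v x) = (S$2$2 * (x$1)\<^sup>2 - 2 * S$1$2 * x$1 * x$2 + S$1$1 * (x$2)\<^sup>2) / det S" for x :: "real^2"
    using assms
    by (simp add: matrix_inv_2 inner_vec_def matrix_vector_mult_def sum_2 power2_eq_square add_divide_distrib diff_divide_distrib algebra_simps)
  moreover have "sqrt ((2 * pi)\<^sup>2 * det S) = 2 * pi * sqrt (det S)"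
    by (simp add: real_sqrt_mult)
  moreover have "- (y / z) / 2 = - y / (2 * z)" for y z :: real
    by simp
  ultimately have e: "exp (- ((x - 0) \<bullet> (matrix_inv S *v (x - 0))) / 2) / sqrt ((2 * pi) ^ CARD(2) * det S) =
    bivariate_normal_density (S$1$1) (S$1$2) (S$2$2) (x$1, x$2)" for x :: "real^2"
    by (simp only: bivariate_normal_density_def d[symmetric] prod.case diff_zero) simp
  show ?thesis
    unfolding multivariate_normal_def e ..
qed

text \<open>The form in which the limit law of the estimator arises. Two of the vectors span the
  plane, so \<open>S\<close> has positive determinant and its density form is meaningful; the two
  measures are compared on indicators pulled back to pairs.\<close>

lemma distr_PiM_std_normals:
  fixes w :: "'i \<Rightarrow> real^2"
  assumes I: "finite I" "i \<in> I" "j \<in> I" and ij: "w i $ 1 * w j $ 2 - w j $ 1 * w i $ 2 \<noteq> 0"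
  defines "S \<equiv> (\<chi> a b. \<Sum>l\<in>I. w l $ a * w l $ b)"
  shows "distr (PiM I (\<lambda>_. density lborel std_normal_density)) borel (\<lambda>z. \<Sum>l\<in>I. z l *\<^sub>R w l) = multivariate_normal 0 S"
proof (rule measure_eqI)
  define K where "K = I - {i, j}"
  have "i \<noteq> j" using ij by auto
  have IK: "I = K \<union> {i, j}" and K: "finite K" "i \<notin> K" "j \<notin> K"
    using I by (auto simp: K_def)
  note gauss = nn_integral_PiM_std_normals[OF _ K \<open>i \<noteq> j\<close> ij, folded IK]
  have S: "S$1$1 = (\<Sum>l\<in>I. (w l $ 1)\<^sup>2)" "S$1$2 = (\<Sum>l\<in>I. w l $ 1 * w l $ 2)" "S$2$2 = (\<Sum>l\<in>I. (w l $ 2)\<^sup>2)" "S$2$1 = S$1$2"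
    by (simp_all add: S_def power2_eq_square mult.commute)
  have d: "0 < det S"
    using covariance_det_pos[OF I ij] by (simp add: det_2 S power2_eq_square)
  note mn = multivariate_normal_2[OF S(4) d]
  fix A assume "A \<in> sets (distr (PiM I (\<lambda>_. density lborel std_normal_density)) borel (\<lambda>z. \<Sum>l\<in>I. z l *\<^sub>R w l))"
  then have [measurable]: "A \<in> sets borel" by simp
  let ?f = "\<lambda>p :: real \<times> real. indicator A (vector [fst p, snd p] :: real^2) :: ennreal"
  have v: "vector [fst (\<Sum>l\<in>I. z l *\<^sub>R (w l $ 1, w l $ 2)), snd (\<Sum>l\<in>I. z l *\<^sub>R (w l $ 1, w l $ 2))] = (\<Sum>l\<in>I. z l *\<^sub>R w l)" for z
    by (simp add: vec_eq_iff forall_2 fst_sum snd_sum)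
  have "emeasure (distr (PiM I (\<lambda>_. density lborel std_normal_density)) borel (\<lambda>z. \<Sum>l\<in>I. z l *\<^sub>R w l)) A
      = (\<integral>\<^sup>+x. indicator A x \<partial>distr (PiM I (\<lambda>_. density lborel std_normal_density)) borel (\<lambda>z. \<Sum>l\<in>I. z l *\<^sub>R w l))"
    by simp
  also have "\<dots> = (\<integral>\<^sup>+z. ?f (\<Sum>l\<in>I. z l *\<^sub>R (w l $ 1, w l $ 2)) \<partial>PiM I (\<lambda>_. density lborel std_normal_density))"
    unfolding v by (rule nn_integral_distr) measurable
  also have "\<dots> = (\<integral>\<^sup>+p. ?f p * bivariate_normal_density (S$1$1) (S$1$2) (S$2$2) p \<partial>lborel)"
    unfolding S by (intro gauss) measurable
  also have "\<dots> = (\<integral>\<^sup>+x. (indicator A x :: ennreal) * bivariate_normal_density (S$1$1) (S$1$2) (S$2$2) (x$1, x$2) \<partial>lborel)"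
  proof -
    have [measurable]: "(\<lambda>x::real^2. (x$1, x$2)) \<in> borel_measurable borel"
      unfolding borel_prod[symmetric] by measurable
    show ?thesis
      by (subst lborel_vec_2, subst nn_integral_distr) simp_all
  qed
  also have "\<dots> = emeasure (multivariate_normal 0 S) A"
    unfolding mn by (subst emeasure_density) (simp_all add: mult.commute)
  finally show "emeasure (distr (PiM I (\<lambda>_. density lborel std_normal_density)) borel (\<lambda>z. \<Sum>l\<in>I. z l *\<^sub>R w l)) A = emeasure (multivariate_normal 0 S) A" .
qed (simp add: multivariate_normal_def)

subsection \<open>Poisson variables and the strong law of large numbers\<close>

text \<open>For a nonnegative function a single convergent series yields both integrability and the
  value of the integral.\<close>

lemma has_bochner_integral_pmf_nat:
  fixes g :: "nat \<Rightarrow> real"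
  assumes "\<And>x. 0 \<le> g x" "(\<lambda>x. pmf q x * g x) sums s"
  shows "has_bochner_integral (measure_pmf q) g s"
proof (rule has_bochner_integral_nn_integral)
  show "0 \<le> s"
    using assms sums_le[of "\<lambda>_. 0" "\<lambda>x. pmf q x * g x" 0 s] by simp
  have "(\<integral>\<^sup>+x. g x \<partial>measure_pmf q) = (\<integral>\<^sup>+x. ennreal (pmf q x * g x) \<partial>count_space UNIV)"
    using assms(1) by (simp add: nn_integral_measure_pmf ennreal_mult)
  also have "\<dots> = ennreal s"
    unfolding nn_integral_count_space_nat using assms by (intro suminf_ennreal_eq) auto
  finally show "(\<integral>\<^sup>+x. g x \<partial>measure_pmf q) = ennreal s" .
qed (use assms in auto)

lemma sums_pmf:
  "(\<lambda>x. pmf q x) sums 1" for q :: "nat pmf"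
proof -
  have "integrable (count_space UNIV) (pmf q)"
    by (rule integrable_pmf)
  then show ?thesis
    using sums_integral_count_space_nat[of "pmf q"] integral_pmf[of UNIV q] by simp
qed

context
  fixes m :: real
  assumes m: "0 < m"
begin

text \<open>The recursion \<open>pmf (Suc x) * Suc x = m * pmf x\<close> reduces a moment to lower
  ones. The index shift is free because the term at \<open>0\<close> vanishes.\<close>

lemma poisson_sums_1: "(\<lambda>x. pmf (poisson_pmf m) x * real x) sums m"
proof -
  have "(\<lambda>x. pmf (poisson_pmf m) (Suc x) * real (Suc x)) sums (m * 1)"
  proof (rule sums_cong[THEN iffD1])
    show "(\<lambda>x. m * pmf (poisson_pmf m) x) sums (m * 1)"
      by (intro sums_mult sums_pmf)
  qed (use m in \<open>simp add: field_simps del: of_nat_Suc\<close>)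
  then show ?thesis
    by (subst (asm) sums_Suc_iff) simp
qed

lemma poisson_sums_2: "(\<lambda>x. pmf (poisson_pmf m) x * (real x)\<^sup>2) sums (m\<^sup>2 + m)"
proof -
  have e: "pmf (poisson_pmf m) (Suc x) * real (Suc x) = m * pmf (poisson_pmf m) x" for x
    using m by (simp add: field_simps del: of_nat_Suc)
  have "(\<lambda>x. pmf (poisson_pmf m) (Suc x) * (real (Suc x))\<^sup>2) sums (m * (m + 1))"
  proof (rule sums_cong[THEN iffD1])
    show "(\<lambda>x. m * (pmf (poisson_pmf m) x * real x + pmf (poisson_pmf m) x)) sums (m * (m + 1))"
      by (intro sums_mult sums_add sums_pmf poisson_sums_1)
    fix x
    show "m * (pmf (poisson_pmf m) x * real x + pmf (poisson_pmf m) x) = pmf (poisson_pmf m) (Suc x) * (real (Suc x))\<^sup>2"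
      unfolding power2_eq_square mult.assoc[symmetric] e by (simp add: algebra_simps)
  qed
  then show ?thesis
    by (subst (asm) sums_Suc_iff) (simp add: algebra_simps power2_eq_square)
qed

lemma has_bochner_integral_poisson_mean:
  "has_bochner_integral (measure_pmf (poisson_pmf m)) real m"
  by (intro has_bochner_integral_pmf_nat poisson_sums_1) simp

lemma has_bochner_integral_poisson_variance:
  "has_bochner_integral (measure_pmf (poisson_pmf m)) (\<lambda>x. (real x - m)\<^sup>2) m"
proof -
  have "has_bochner_integral (measure_pmf (poisson_pmf m)) (\<lambda>x. (real x)\<^sup>2) (m\<^sup>2 + m)"
    by (intro has_bochner_integral_pmf_nat poisson_sums_2) simp
  moreover have "has_bochner_integral (measure_pmf (poisson_pmf m)) (\<lambda>_. m\<^sup>2) (m\<^sup>2)"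
    by (simp add: has_bochner_integral_iff measure_pmf.prob_space)
  ultimately have "has_bochner_integral (measure_pmf (poisson_pmf m))
      (\<lambda>x. (real x)\<^sup>2 - 2 * m * real x + m\<^sup>2) (m\<^sup>2 + m - 2 * m * m + m\<^sup>2)"
    by (intro has_bochner_integral_add has_bochner_integral_diff has_bochner_integral_mult_right has_bochner_integral_poisson_mean)
  then show ?thesis
    by (simp add: algebra_simps power2_eq_square)
qed

text \<open>The moment generating function of the centred variable, obtained from the exponential
  series at \<open>m * exp a\<close>.\<close>

lemma nn_integral_poisson_exp:
  "(\<integral>\<^sup>+x. ennreal (exp (a * (real x - m))) \<partial>measure_pmf (poisson_pmf m)) = ennreal (exp (m * (exp a - 1 - a)))"
proof -
  have "(\<lambda>x. exp (- m - a * m) * ((m * exp a) ^ x /\<^sub>R fact x)) sums (exp (- m - a * m) * exp (m * exp a))"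
    by (intro sums_mult exp_converges)
  moreover have "exp (- m - a * m) * ((m * exp a) ^ x /\<^sub>R fact x) = pmf (poisson_pmf m) x * exp (a * (real x - m))" for x
  proof -
    have "exp (- m - a * m) * exp (a * real x) = exp (- m) * exp (a * (real x - m))"
      by (simp add: exp_add[symmetric] algebra_simps)
    moreover have "exp a ^ x = exp (a * real x)"
      by (simp add: exp_of_nat_mult[symmetric] mult.commute)
    ultimately show ?thesis
      using m by (simp add: power_mult_distrib field_simps)
  qed
  moreover have "exp (- m - a * m) * exp (m * exp a) = exp (m * (exp a - 1 - a))"
    by (simp add: exp_add[symmetric] algebra_simps)
  ultimately have "has_bochner_integral (measure_pmf (poisson_pmf m)) (\<lambda>x. exp (a * (real x - m))) (exp (m * (exp a - 1 - a)))"
    by (intro has_bochner_integral_pmf_nat) auto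
  then show ?thesis
    by (subst nn_integral_eq_integral) (auto simp: has_bochner_integral_iff)
qed

end

section \<open>Exponential tail bounds and the strong law\<close>

lemma exp_le_quadratic:
  fixes x :: real
  assumes "\<bar>x\<bar> \<le> 1"
  shows "exp x \<le> 1 + x + x\<^sup>2"
proof (cases "0 \<le> x")
  case True
  then show ?thesis using exp_bound[of x] assms by simp
next
  case False
  define y where "y = - x"
  have y: "0 \<le> y" "y \<le> 1" using assms False by (auto simp: y_def)
  \<comment> \<open>For \<open>x = - y\<close> the claim is
    \<open>1 \<le> (1 - y + y\<^sup>2) * exp y\<close>. The factor \<open>exp y\<close> is bounded
    below by its quadratic Taylor polynomial, and the remaining product exceeds \<open>1\<close> by
    nonnegative terms.\<close>
  have "1 \<le> (1 - y + y\<^sup>2) * (1 + y + y\<^sup>2 / 2)"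
  proof -
    have "(1 - y + y\<^sup>2) * (1 + y + y\<^sup>2 / 2) = 1 + (y\<^sup>2 + y ^ 3 + y ^ 4) / 2"
      by (simp add: field_simps power2_eq_square power3_eq_cube power4_eq_xxxx)
    then show ?thesis using y by simp
  qed
  also have "\<dots> \<le> (1 - y + y\<^sup>2) * exp y"
    using y exp_lower_Taylor_quadratic[of y] by (intro mult_left_mono) auto
  finally have "exp (- y) \<le> 1 - y + y\<^sup>2"
    by (simp add: exp_minus field_simps)
  then show ?thesis by (simp add: y_def)
qed

text \<open>Chernoff's bound followed by the Borel--Cantelli lemma.\<close>

lemma (in prob_space) AE_eventually_sum_less:
  fixes Y :: "nat \<Rightarrow> 'a \<Rightarrow> real"
  assumes indep: "indep_vars (\<lambda>_. borel) Y UNIV" and c: "0 < c" and e: "0 < e"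
    and mgf: "\<And>a j. 0 < a \<Longrightarrow> a \<le> 1 \<Longrightarrow> (\<integral>\<^sup>+x. ennreal (exp (a * Y j x)) \<partial>M) \<le> ennreal (exp (c * a\<^sup>2))"
  shows "AE x in M. \<forall>\<^sub>F n in sequentially. (\<Sum>j<n. Y j x) < real n * e"
proof -
  have [measurable]: "Y j \<in> borel_measurable M" for j
    using indep by (auto simp: indep_vars_def)
  \<comment> \<open>\<open>e / (2 * c)\<close> minimises the Chernoff exponent
    \<open>c * a\<^sup>2 - a * e\<close>. The cap at \<open>1\<close> keeps \<open>a\<close> where
    the bound on the moment generating function is available; in both cases the exponent is at most
    \<open>- a * e / 2\<close>.\<close>
  define a where "a = min 1 (e / (2 * c))"
  have a: "0 < a" "a \<le> 1" "c * a\<^sup>2 \<le> a * e / 2"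
  proof -
    show "0 < a" "a \<le> 1" using c e by (auto simp: a_def)
    moreover have "c * a \<le> e / 2"
      using c by (auto simp: a_def min_def field_simps)
    ultimately show "c * a\<^sup>2 \<le> a * e / 2"
      by (simp add: power2_eq_square mult_ac)
  qed
  define A where "A n = {x \<in> space M. real n * e \<le> (\<Sum>j<n. Y j x)}" for n
  have [measurable]: "A n \<in> sets M" for n
    unfolding A_def by measurable
  have bound: "measure M (A n) \<le> exp (- a * e / 2) ^ n" for n
  proof -
    have "emeasure M (A n) \<le> ennreal (exp (- a * (real n * e))) * (\<integral>\<^sup>+x. ennreal (exp (a * (\<Sum>j<n. Y j x))) * indicator (space M) x \<partial>M)"
      unfolding A_def by (rule Chernoff_ineq_nn_integral_ge) (use a in auto)
    also have "(\<integral>\<^sup>+x. ennreal (exp (a * (\<Sum>j<n. Y j x))) * indicator (space M) x \<partial>M)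
        = (\<integral>\<^sup>+x. (\<Prod>j\<in>{..<n}. ennreal (exp (a * Y j x))) \<partial>M)"
      by (intro nn_integral_cong) (simp add: sum_distrib_left exp_sum prod_ennreal)
    also have "\<dots> = (\<Prod>j\<in>{..<n}. \<integral>\<^sup>+x. ennreal (exp (a * Y j x)) \<partial>M)"
      by (intro indep_vars_nn_integral indep_vars_compose2[OF indep_vars_subset[OF indep]]) auto
    also have "\<dots> \<le> (\<Prod>j\<in>{..<n}. ennreal (exp (c * a\<^sup>2)))"
      using a by (intro prod_mono_ennreal mgf) auto
    also have "\<dots> = ennreal (exp (real n * (c * a\<^sup>2)))"
      by (simp add: ennreal_power exp_of_nat_mult)
    also have "ennreal (exp (- a * (real n * e))) * ennreal (exp (real n * (c * a\<^sup>2)))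
       = ennreal (exp (real n * (c * a\<^sup>2 - a * e)))"
      by (simp add: ennreal_mult'[symmetric] exp_add[symmetric] algebra_simps)
    also have "\<dots> \<le> ennreal (exp (real n * (- a * e / 2)))"
    proof (intro ennreal_leI iffD2[OF exp_le_cancel_iff] mult_left_mono)
      show "c * a\<^sup>2 - a * e \<le> - a * e / 2"
        using a(3) by (simp add: field_simps)
    qed simp
    also have "exp (real n * (- a * e / 2)) = exp (- a * e / 2) ^ n"
      by (rule exp_of_nat_mult)
    finally show ?thesis
      by (simp add: emeasure_eq_measure mult_left_mono)
  qed
  have "summable (\<lambda>n. measure M (A n))"
  proof (rule summable_comparison_test')
    show "summable (\<lambda>n. exp (- a * e / 2) ^ n)"
      using a e by (intro summable_geometric) simp
    show "norm (measure M (A n)) \<le> exp (- a * e / 2) ^ n" if "0 \<le> n" for n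
      using bound[of n] by simp
  qed
  then have "AE x in M. \<forall>\<^sub>F n in sequentially. x \<in> space M - A n"
    by (intro borel_cantelli_AE1) (auto simp: emeasure_eq_measure)
  then show ?thesis
  proof (rule AE_mp, intro AE_I2 impI)
    fix x assume "\<forall>\<^sub>F n in sequentially. x \<in> space M - A n"
    then show "\<forall>\<^sub>F n in sequentially. (\<Sum>j<n. Y j x) < real n * e"
      by eventually_elim (auto simp: A_def not_le)
  qed
qed

text \<open>The hypothesis is symmetric in \<open>a\<close>, so the one-sided bound applies to
  \<open>Y\<close> and to \<open>- Y\<close>. Taking the thresholds \<open>1 / Suc r\<close> leaves
  only countably many null sets to discard.\<close>

lemma (in prob_space) strong_law_subexponential:
  fixes Y :: "nat \<Rightarrow> 'a \<Rightarrow> real"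
  assumes indep: "indep_vars (\<lambda>_. borel) Y UNIV" and c: "0 < c"
    and mgf: "\<And>a j. \<bar>a\<bar> \<le> 1 \<Longrightarrow> (\<integral>\<^sup>+x. ennreal (exp (a * Y j x)) \<partial>M) \<le> ennreal (exp (c * a\<^sup>2))"
  shows "AE x in M. (\<lambda>n. (\<Sum>j<n. Y j x) / real n) \<longlonglongrightarrow> 0"
proof -
  have indep': "indep_vars (\<lambda>_. borel) (\<lambda>j x. - Y j x) UNIV"
    by (rule indep_vars_compose2[OF indep]) auto
  have "AE x in M. \<forall>r::nat. (\<forall>\<^sub>F n in sequentially. (\<Sum>j<n. Y j x) < real n * (1 / real (Suc r))) \<and>
      (\<forall>\<^sub>F n in sequentially. (\<Sum>j<n. - Y j x) < real n * (1 / real (Suc r)))"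
    unfolding AE_all_countable
  proof (intro allI AE_conjI)
    fix r :: nat
    show "AE x in M. \<forall>\<^sub>F n in sequentially. (\<Sum>j<n. Y j x) < real n * (1 / real (Suc r))"
      using mgf by (intro AE_eventually_sum_less[OF indep c]) auto
    show "AE x in M. \<forall>\<^sub>F n in sequentially. (\<Sum>j<n. - Y j x) < real n * (1 / real (Suc r))"
      using mgf[of "- a" for a] by (intro AE_eventually_sum_less[OF indep' c]) auto
  qed
  then show ?thesis
  proof (rule AE_mp, intro AE_I2 impI)
    fix x assume *: "\<forall>r::nat. (\<forall>\<^sub>F n in sequentially. (\<Sum>j<n. Y j x) < real n * (1 / real (Suc r))) \<and>
      (\<forall>\<^sub>F n in sequentially. (\<Sum>j<n. - Y j x) < real n * (1 / real (Suc r)))"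
    show "(\<lambda>n. (\<Sum>j<n. Y j x) / real n) \<longlonglongrightarrow> 0"
    proof (rule tendstoI)
      fix e :: real assume "0 < e"
      then obtain r where r: "1 / real (Suc r) < e"
        using nat_approx_posE by blast
      from *[rule_format, of r] have
        "\<forall>\<^sub>F n in sequentially. (\<Sum>j<n. Y j x) < real n * (1 / real (Suc r))"
        "\<forall>\<^sub>F n in sequentially. (\<Sum>j<n. - Y j x) < real n * (1 / real (Suc r))"
        by auto
      then show "\<forall>\<^sub>F n in sequentially. dist ((\<Sum>j<n. Y j x) / real n) 0 < e"
        using eventually_gt_at_top[of 0]
      proof eventually_elim
        case (elim n)
        then have "\<bar>\<Sum>j<n. Y j x\<bar> < real n * (1 / real (Suc r))"
          by (simp add: sum_negf abs_less_iff)
        then have "\<bar>\<Sum>j<n. Y j x\<bar> / real n < 1 / real (Suc r)"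
          using elim by (simp add: field_simps)
        then show ?case using r by (simp add: dist_real_def)
      qed
    qed
  qed
qed

text \<open>Serves to extract from the independent array the sequence of a single layer, with rounds
  renumbered from \<open>0\<close>.\<close>

lemma (in prob_space) indep_vars_reindex:
  assumes "indep_vars M' X I" "inj_on f J" "f ` J \<subseteq> I"
  shows "indep_vars (\<lambda>j. M' (f j)) (\<lambda>j. X (f j)) J"
  unfolding indep_vars_def2
proof (intro conjI ballI)
  fix j assume "j \<in> J"
  then show "random_variable (M' (f j)) (X (f j))"
    using assms by (auto simp: indep_vars_def2)
next
  let ?F = "\<lambda>i. {X i -` A \<inter> space M |A. A \<in> sets (M' i)}"
  have ind: "indep_sets ?F I"
    using assms by (simp add: indep_vars_def2)
  show "indep_sets (\<lambda>j. ?F (f j)) J"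
  proof (rule indep_setsI)
    fix j assume "j \<in> J"
    then show "?F (f j) \<subseteq> events"
      using ind assms by (auto simp: indep_sets_def)
  next
    fix A K assume K: "K \<noteq> {}" "K \<subseteq> J" "finite K" and A: "\<forall>j\<in>K. A j \<in> ?F (f j)"
    have inj: "inj_on f K"
      using assms K inj_on_subset by blast
    define A' where "A' i = A (the_inv_into K f i)" for i
    have A': "A' (f j) = A j" if "j \<in> K" for j
      using that inj by (simp add: A'_def the_inv_into_f_f)
    have "prob (\<Inter>i\<in>f ` K. A' i) = (\<Prod>i\<in>f ` K. prob (A' i))"
      using ind K assms(3) A A' by (intro indep_setsD[OF ind]) auto
    then show "prob (\<Inter>j\<in>K. A j) = (\<Prod>j\<in>K. prob (A j))"
      using A' by (simp add: prod.reindex[OF inj])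
  qed
qed

subsection \<open>The mean map and the Fisher information\<close>

definition detector_params :: "(real^2) set" where
  "detector_params = {\<theta>. 0 < \<theta>$1 \<and> \<theta>$1 < 1 \<and> 0 < \<theta>$2}"

text \<open>The coefficients with which a count in layer \<open>i\<close> enters
  \<open>s\<^sub>n\<close> and \<open>z\<^sub>n\<close>.\<close>

definition layer_weight :: "nat \<Rightarrow> real^2" where
  "layer_weight i = vector [1, real i - 1]"

definition mean_map :: "nat \<Rightarrow> real \<Rightarrow> real^2 \<Rightarrow> real^2" where
  "mean_map k t \<theta> = (\<Sum>i=1..k. layer_mean t i \<theta> *\<^sub>R layer_weight i)"

text \<open>The gradient of \<open>ln (layer_mean t i \<theta>)\<close> for \<open>i \<ge> 1\<close>
  on \<open>detector_params\<close>. It is linear in \<open>layer_weight i\<close>, which drives the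
  computation of the inverse derivative.\<close>

definition log_mean_grad :: "nat \<Rightarrow> real^2 \<Rightarrow> real^2" where
  "log_mean_grad i \<theta> = vector [1 / \<theta>$1 - (real i - 1) / (1 - \<theta>$1), 1 / \<theta>$2]"

lemma open_detector_params: "open detector_params"
  unfolding detector_params_def
  by (intro open_Collect_conj open_Collect_less continuous_intros)

lemma layer_mean_pos: "\<theta> \<in> detector_params \<Longrightarrow> 0 < t \<Longrightarrow> 0 < layer_mean t i \<theta>"
  by (simp add: detector_params_def layer_mean_def)

text \<open>The first score equation is the first moment equation. The second one mixes both
  averages and becomes the second moment equation only in the presence of the first.\<close>

lemma score_solutions_eq:
  assumes t: "0 < t"
  shows "score_solutions k t n x =
    {\<theta> \<in> detector_params. mean_map k t \<theta> = vector [mean_count k n x, mean_weighted_count k n x]}"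
proof -
  have "lambda_score k t n x \<theta> = 0 \<and> p_score k t n x \<theta> = 0 \<longleftrightarrow>
      mean_map k t \<theta> = vector [mean_count k n x, mean_weighted_count k n x]"
    if \<theta>: "\<theta> \<in> detector_params" for \<theta>
  proof -
    define p q l where "p = \<theta>$1" and "q = 1 - \<theta>$1" and "l = \<theta>$2"
    define s z where "s = mean_count k n x" and "z = mean_weighted_count k n x"
    have pos: "0 < p" "0 < q" "0 < l" and pq: "p = 1 - q"
      using \<theta> by (auto simp: detector_params_def p_def q_def l_def)
    have 1: "(\<Sum>i=1..k. p * q ^ (i - 1)) = 1 - q ^ k"
      by (induction k) (auto simp: algebra_simps pq)
    \<comment> \<open>The factor \<open>p\<close> clears the denominator of the closed form, so that
      the induction is a polynomial identity.\<close>
    have 2: "p * (\<Sum>i=1..k. (real i - 1) * (p * q ^ (i - 1))) = q * (1 - q ^ k) - real k * p * q ^ k"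
      by (induction k) (auto simp: algebra_simps pq)
    have m1: "mean_map k t \<theta> $ 1 = l * t * (1 - q ^ k)"
      unfolding 1[symmetric] sum_distrib_left
      by (auto simp: mean_map_def layer_weight_def layer_mean_def p_def q_def l_def mult_ac intro!: sum.cong)
    have m2: "p * mean_map k t \<theta> $ 2 = l * t * (q * (1 - q ^ k) - real k * p * q ^ k)"
      unfolding 2[symmetric] sum_distrib_left mean_map_def
      by (auto simp: mean_map_def layer_weight_def layer_mean_def p_def q_def l_def mult_ac sum_distrib_left intro!: sum.cong)
    have "lambda_score k t n x \<theta> = 0 \<longleftrightarrow> s = mean_map k t \<theta> $ 1"
      using pos by (simp add: lambda_score_def Let_def m1 s_def q_def[symmetric] l_def[symmetric])
    moreover have "p_score k t n x \<theta> = 0 \<longleftrightarrow> q * s - p * z = l * t * (real k * p * q ^ k)"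
    proof -
      have "p_score k t n x \<theta> = 0 \<longleftrightarrow> q * (s + z) - z - l * t * (real k * q ^ k - real k * q ^ (k + 1)) = 0"
        unfolding p_score_def Let_def s_def[symmetric] z_def[symmetric] q_def[symmetric]
        unfolding p_def[symmetric] l_def[symmetric] using pos by simp
      also have "q * (s + z) - z - l * t * (real k * q ^ k - real k * q ^ (k + 1))
          = q * s - p * z - l * t * (real k * p * q ^ k)"
        by (simp add: pq algebra_simps)
      finally show ?thesis by simp
    qed
    \<comment> \<open>\<open>mean_map\<close> satisfies the same linear relation, so subtracting it
      leaves \<open>p * z = p * mean_map k t \<theta> $ 2\<close>.\<close>
    moreover have "q * s - p * z = l * t * (real k * p * q ^ k) \<longleftrightarrow> z = mean_map k t \<theta> $ 2"
      if "s = mean_map k t \<theta> $ 1"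
    proof -
      have "q * s - p * mean_map k t \<theta> $ 2 = l * t * (real k * p * q ^ k)"
        unfolding m2 that m1 by (simp add: algebra_simps)
      then show ?thesis
        using pos by (metis add_diff_cancel_left' diff_eq_eq mult_cancel_left less_irrefl)
    qed
    ultimately have "lambda_score k t n x \<theta> = 0 \<and> p_score k t n x \<theta> = 0 \<longleftrightarrow>
        s = mean_map k t \<theta> $ 1 \<and> z = mean_map k t \<theta> $ 2"
      by blast
    then show ?thesis
      unfolding vec_eq_iff forall_2 vector_2 s_def z_def by (simp only: eq_commute)
  qed
  then show ?thesis
    by (auto simp: score_solutions_def detector_params_def)
qed

text \<open>If two parameters have the same image, the log ratio of their layer means is affine in the
  layer, hence orthogonal to the difference of the layer means; strict monotonicity of the logarithm
  forces all layer means to agree.\<close>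

lemma inj_on_mean_map:
  assumes t: "0 < t" and k: "1 < k"
  shows "inj_on (mean_map k t) detector_params"
proof (rule inj_onI)
  fix \<theta> \<eta> assume \<theta>: "\<theta> \<in> detector_params" and \<eta>: "\<eta> \<in> detector_params"
    and eq: "mean_map k t \<theta> = mean_map k t \<eta>"
  let ?m = "\<lambda>i. layer_mean t i \<theta>" and ?m' = "\<lambda>i. layer_mean t i \<eta>"
  define a where "a = ln (\<theta>$1 * \<theta>$2 * t) - ln (\<eta>$1 * \<eta>$2 * t)"
  define b where "b = ln (1 - \<theta>$1) - ln (1 - \<eta>$1)"
  have ln_m: "ln (layer_mean t i \<zeta>) = ln (\<zeta>$1 * \<zeta>$2 * t) + (real i - 1) * ln (1 - \<zeta>$1)"
    if "\<zeta> \<in> detector_params" "1 \<le> i" for i and \<zeta> :: "real^2"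
  proof -
    have "layer_mean t i \<zeta> = (\<zeta>$1 * \<zeta>$2 * t) * (1 - \<zeta>$1) ^ (i - 1)"
      by (simp add: layer_mean_def mult_ac)
    then show ?thesis
      using that t by (simp add: detector_params_def ln_mult_pos ln_realpow of_nat_diff)
  qed
  have d: "ln (?m i) - ln (?m' i) = a + (real i - 1) * b" if "i \<in> {1..k}" for i
    using ln_m[OF \<theta>, of i] ln_m[OF \<eta>, of i] that by (simp add: a_def b_def algebra_simps)
  have eq1: "(\<Sum>i=1..k. ?m i) = (\<Sum>i=1..k. ?m' i)"
    using arg_cong[OF eq, of "\<lambda>v. v$1"] by (simp add: mean_map_def layer_weight_def)
  have eq2: "(\<Sum>i=1..k. ?m i * (real i - 1)) = (\<Sum>i=1..k. ?m' i * (real i - 1))"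
    using arg_cong[OF eq, of "\<lambda>v. v$2"] by (simp add: mean_map_def layer_weight_def)
  have "(\<Sum>i=1..k. (?m i - ?m' i) * (ln (?m i) - ln (?m' i)))
      = (\<Sum>i=1..k. a * (?m i - ?m' i) + b * (?m i * (real i - 1) - ?m' i * (real i - 1)))"
    by (intro sum.cong refl) (simp add: d algebra_simps)
  also have "\<dots> = 0"
    by (simp add: sum.distrib sum_distrib_left[symmetric] sum_subtractf eq1 eq2 del: One_nat_def)
  finally have "(\<Sum>i=1..k. (?m i - ?m' i) * (ln (?m i) - ln (?m' i))) = 0" .
  moreover have nonneg: "0 \<le> (?m i - ?m' i) * (ln (?m i) - ln (?m' i))" for i
    using layer_mean_pos[OF \<theta> t, of i] layer_mean_pos[OF \<eta> t, of i]
    by (cases "?m i \<le> ?m' i") (auto simp: mult_nonpos_nonpos)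
  ultimately have zero: "(?m i - ?m' i) * (ln (?m i) - ln (?m' i)) = 0" if "i \<in> {1..k}" for i
    using that by (simp add: sum_nonneg_eq_0_iff)
  have m: "?m i = ?m' i" if "i \<in> {1..k}" for i
    using zero[OF that] layer_mean_pos[OF \<theta> t, of i] layer_mean_pos[OF \<eta> t, of i] by auto
  \<comment> \<open>Two layers suffice to recover the parameters: the first mean determines
    \<open>p * \<lambda>\<close>, and the ratio of the second to the first is
    \<open>1 - p\<close>.\<close>
  have m1: "\<theta>$1 * \<theta>$2 = \<eta>$1 * \<eta>$2"
    using m[of 1] k t by (simp add: layer_mean_def)
  have "\<theta>$1 * \<theta>$2 * (1 - \<theta>$1) = \<eta>$1 * \<eta>$2 * (1 - \<eta>$1)"
    using m[of 2] k t by (simp add: layer_mean_def mult_ac)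
  then have "\<theta>$1 = \<eta>$1"
    using m1 \<eta> by (simp add: detector_params_def)
  then show "\<theta> = \<eta>"
    using m1 \<eta> by (simp add: vec_eq_iff forall_2 detector_params_def)
qed

section \<open>Derivative of the mean map and the Fisher information\<close>

lemma layer_mean_has_derivative:
  assumes \<theta>: "\<theta> \<in> detector_params" and i: "1 \<le> i"
  shows "(layer_mean t i has_derivative (\<lambda>h. layer_mean t i \<theta> * (log_mean_grad i \<theta> \<bullet> h))) (at \<theta>)"
proof -
  note [derivative_intros] = bounded_linear.has_derivative[OF bounded_linear_vec_nth]
  have pos: "0 < \<theta>$1" "0 < 1 - \<theta>$1" "0 < \<theta>$2"
    using \<theta> by (auto simp: detector_params_def)
  \<comment> \<open>At \<open>i = 1\<close> the exponent \<open>i - 1 - 1\<close> is truncated, but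
    the factor \<open>real (i - 1)\<close> vanishes; division by \<open>1 - p\<close> treats all
    layers uniformly.\<close>
  have pw: "real (i - 1) * (1 - \<theta>$1) ^ (i - 1 - 1) = (real i - 1) * (1 - \<theta>$1) ^ (i - 1) / (1 - \<theta>$1)"
    using pos i by (cases "i - 1") (auto simp: of_nat_diff)
  have "((\<lambda>\<theta>. \<theta>$1 * (1 - \<theta>$1) ^ (i - 1) * \<theta>$2 * t) has_derivative
      (\<lambda>h. (\<theta>$1 * (1 - \<theta>$1) ^ (i - 1) * h$2 + (\<theta>$1 * (real (i - 1) * (1 - \<theta>$1) ^ (i - 1 - 1) * (- h$1)) + h$1 * (1 - \<theta>$1) ^ (i - 1)) * \<theta>$2) * t)) (at \<theta>)"
    by (auto intro!: derivative_eq_intros simp: algebra_simps)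
  also have "(\<lambda>h. (\<theta>$1 * (1 - \<theta>$1) ^ (i - 1) * h$2 + (\<theta>$1 * (real (i - 1) * (1 - \<theta>$1) ^ (i - 1 - 1) * (- h$1)) + h$1 * (1 - \<theta>$1) ^ (i - 1)) * \<theta>$2) * t)
     = (\<lambda>h. layer_mean t i \<theta> * (log_mean_grad i \<theta> \<bullet> h))"
  proof -
    have "(x * A * h2 + (x * (n * A / y * (- h1)) + h1 * A) * l) * t = x * A * l * t * ((1 / x - n / y) * h1 + 1 / l * h2)"
      if "0 < x" "0 < y" "0 < l" for x y l A n h1 h2 :: real
      using that by (simp add: field_simps)
    from this[OF pos] show ?thesis
      unfolding pw layer_mean_def log_mean_grad_def inner_vec_def sum_2 vector_2 inner_real_def
      by (intro ext)
  qed
  finally show ?thesis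
    unfolding layer_mean_def[abs_def] .
qed

lemma mean_map_has_derivative:
  assumes "\<theta> \<in> detector_params"
  shows "(mean_map k t has_derivative
    (\<lambda>h. \<Sum>i=1..k. (layer_mean t i \<theta> * (log_mean_grad i \<theta> \<bullet> h)) *\<^sub>R layer_weight i)) (at \<theta>)"
  unfolding mean_map_def
  by (intro has_derivative_sum has_derivative_scaleR_left layer_mean_has_derivative assms) auto

text \<open>The score is the gradient of \<open>ln m\<close> times \<open>x - m\<close>, so the
  expectation of the product of two scores reduces to the Poisson variance, which is
  \<open>m\<close>.\<close>

lemma layer_fisher_information:
  assumes \<theta>: "\<theta> \<in> detector_params" and t: "0 < t" and i: "1 \<le> i"
  shows "fisher_information (\<lambda>\<theta>'. poisson_pmf (layer_mean t i \<theta>')) \<theta>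
    = (\<chi> a b. layer_mean t i \<theta> * log_mean_grad i \<theta> $ a * log_mean_grad i \<theta> $ b)"
proof -
  let ?m = "layer_mean t i \<theta>" and ?u = "log_mean_grad i \<theta>"
  note pos = layer_mean_pos[OF \<theta> t, of i]
  have score: "score (\<lambda>\<theta>'. poisson_pmf (layer_mean t i \<theta>')) \<theta> a x = ?u $ a * (real x - ?m)" for a x
  proof -
    let ?g = "\<lambda>h. layer_mean t i (\<theta> + h *\<^sub>R axis a 1)"
    have "((\<lambda>h. \<theta> + h *\<^sub>R axis a 1) has_derivative (\<lambda>h. h *\<^sub>R axis a 1)) (at 0)"
      by (auto intro!: derivative_eq_intros)
    moreover have "(layer_mean t i has_derivative (\<lambda>h. ?m * (?u \<bullet> h))) (at (\<theta> + 0 *\<^sub>R axis a 1))"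
      using layer_mean_has_derivative[OF \<theta> i] by simp
    ultimately have "(?g has_derivative (\<lambda>h. ?m * (?u \<bullet> (h *\<^sub>R axis a 1)))) (at 0)"
      by (rule has_derivative_compose)
    moreover have "(\<lambda>h. ?m * (?u \<bullet> (h *\<^sub>R axis a 1))) = (*) (?m * ?u $ a)"
      by (auto simp: inner_axis)
    ultimately have g: "(?g has_real_derivative ?m * ?u $ a) (at 0)"
      by (simp only: has_field_derivative_def)
    have "((\<lambda>h. real x * ln (?g h) - ln (fact x) - ?g h) has_real_derivative
        real x * (?m * ?u $ a / ?m) - ?m * ?u $ a) (at 0)"
      using pos by (auto intro!: derivative_eq_intros g)
    moreover have "real x * (?m * ?u $ a / ?m) - ?m * ?u $ a = ?u $ a * (real x - ?m)"
      using pos by (simp add: algebra_simps)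
    \<comment> \<open>Expanding the logarithm of the mass function needs a positive rate, which
      continuity provides near \<open>h = 0\<close>; the derivative at \<open>0\<close> sees nothing
      else.\<close>
    moreover have "\<forall>\<^sub>F h in nhds 0. ln (pmf (poisson_pmf (?g h)) x) = real x * ln (?g h) - ln (fact x) - ?g h"
    proof -
      have "?g \<midarrow>0\<rightarrow> ?m"
        using DERIV_isCont[OF g] by (simp add: isCont_def)
      then have "\<forall>\<^sub>F h in at 0. 0 < ?g h"
        using pos by (rule order_tendstoD(1))
      then have "\<forall>\<^sub>F h in nhds 0. 0 < ?g h"
        using pos by (simp add: eventually_nhds_conv_at)
      then show ?thesis
      proof eventually_elim
        case (elim h)
        then show ?case
          by (simp add: ln_mult_pos ln_div ln_realpow)
      qed
    qed
    ultimately show ?thesis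
      unfolding score_def by (simp add: deriv_cong_ev DERIV_imp_deriv)
  qed
  have "measure_pmf.expectation (poisson_pmf ?m) (\<lambda>x. (?u $ a * (real x - ?m)) * (?u $ b * (real x - ?m)))
     = ?m * ?u $ a * ?u $ b" for a b
  proof -
    have "measure_pmf.expectation (poisson_pmf ?m) (\<lambda>x. (?u $ a * (real x - ?m)) * (?u $ b * (real x - ?m)))
      = measure_pmf.expectation (poisson_pmf ?m) (\<lambda>x. (?u $ a * ?u $ b) * (real x - ?m)\<^sup>2)"
      by (simp add: power2_eq_square mult_ac)
    also have "\<dots> = (?u $ a * ?u $ b) * ?m"
      using has_bochner_integral_poisson_variance[OF pos]
      by (simp add: has_bochner_integral_iff)
    finally show ?thesis by simp
  qed
  then show ?thesis
    unfolding fisher_information_def score by simp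
qed

lemma total_information_eq:
  assumes \<theta>: "\<theta> \<in> detector_params" and t: "0 < t"
  shows "total_information k t \<theta> =
    (\<chi> a b. \<Sum>i=1..k. layer_mean t i \<theta> * log_mean_grad i \<theta> $ a * log_mean_grad i \<theta> $ b)"
proof -
  have "total_information k t \<theta> =
      (\<Sum>i=1..k. \<chi> a b. layer_mean t i \<theta> * log_mean_grad i \<theta> $ a * log_mean_grad i \<theta> $ b)"
    unfolding total_information_def
    by (intro sum.cong refl layer_fisher_information[OF \<theta> t]) auto
  then show ?thesis
    by (simp add: vec_eq_iff)
qed

text \<open>This is the derivative of \<open>mean_map\<close> with each
  \<open>layer_weight i\<close> replaced by \<open>log_mean_grad i \<theta>\<close>.\<close>

lemma total_information_mult_vec:
  assumes \<theta>: "\<theta> \<in> detector_params" and t: "0 < t"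
  shows "total_information k t \<theta> *v h =
    (\<Sum>i=1..k. (layer_mean t i \<theta> * (log_mean_grad i \<theta> \<bullet> h)) *\<^sub>R log_mean_grad i \<theta>)"
proof (intro vec_eq_iff[THEN iffD2] allI)
  fix a
  let ?u = "\<lambda>i. log_mean_grad i \<theta>"
  have "(total_information k t \<theta> *v h) $ a
      = (\<Sum>i=1..k. layer_mean t i \<theta> * ?u i $ a * ?u i $ 1 * h $ 1 + layer_mean t i \<theta> * ?u i $ a * ?u i $ 2 * h $ 2)"
    by (simp add: total_information_eq[OF \<theta> t] matrix_vector_mult_def sum_2 sum.distrib sum_distrib_right)
  also have "\<dots> = (\<Sum>i=1..k. (layer_mean t i \<theta> * (?u i \<bullet> h)) *\<^sub>R ?u i) $ a"
    by (simp add: inner_vec_def sum_2 algebra_simps)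
  finally show "(total_information k t \<theta> *v h) $ a = (\<Sum>i=1..k. (layer_mean t i \<theta> * (?u i \<bullet> h)) *\<^sub>R ?u i) $ a" .
qed

text \<open>The determinant equals \<open>1 / (\<lambda> * (1 - p))\<close>: the two gradients share
  the second entry \<open>1 / \<lambda>\<close>, and their first entries differ by
  \<open>1 / (1 - p)\<close>.\<close>

lemma log_mean_grad_independent:
  "\<theta> \<in> detector_params \<Longrightarrow>
    log_mean_grad 1 \<theta> $ 1 * log_mean_grad 2 \<theta> $ 2 - log_mean_grad 2 \<theta> $ 1 * log_mean_grad 1 \<theta> $ 2 \<noteq> 0"
  by (auto simp: log_mean_grad_def detector_params_def field_simps)

text \<open>The information matrix is the Gram matrix of the vectors
  \<open>sqrt m\<^sub>i u\<^sub>i\<close>, of which the first two are independent.\<close>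

lemma det_total_information_pos:
  assumes \<theta>: "\<theta> \<in> detector_params" and t: "0 < t" and k: "1 < k"
  shows "0 < det (total_information k t \<theta>)"
proof -
  let ?u = "\<lambda>i. sqrt (layer_mean t i \<theta>) *\<^sub>R log_mean_grad i \<theta>"
  have "0 < (\<Sum>l=1..k. (?u l $ 1)\<^sup>2) * (\<Sum>l=1..k. (?u l $ 2)\<^sup>2) - (\<Sum>l=1..k. ?u l $ 1 * ?u l $ 2)\<^sup>2"
  proof (rule covariance_det_pos)
    have "?u 1 $ 1 * ?u 2 $ 2 - ?u 2 $ 1 * ?u 1 $ 2 = sqrt (layer_mean t 1 \<theta>) * sqrt (layer_mean t 2 \<theta>) *
       (log_mean_grad 1 \<theta> $ 1 * log_mean_grad 2 \<theta> $ 2 - log_mean_grad 2 \<theta> $ 1 * log_mean_grad 1 \<theta> $ 2)"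
      by (simp add: algebra_simps)
    then show "?u 1 $ 1 * ?u 2 $ 2 - ?u 2 $ 1 * ?u 1 $ 2 \<noteq> 0"
      using log_mean_grad_independent[OF \<theta>] layer_mean_pos[OF \<theta> t, of 1] layer_mean_pos[OF \<theta> t, of 2] by simp
  qed (use k in auto)
  moreover have "?u l $ a * ?u l $ b = layer_mean t l \<theta> * log_mean_grad l \<theta> $ a * log_mean_grad l \<theta> $ b" for l a b
  proof -
    have "?u l $ a * ?u l $ b = (sqrt (layer_mean t l \<theta>) * sqrt (layer_mean t l \<theta>)) * log_mean_grad l \<theta> $ a * log_mean_grad l \<theta> $ b"
      by simp
    then show ?thesis
      using layer_mean_pos[OF \<theta> t, of l] by (simp only: real_sqrt_mult_self abs_of_pos)
  qed
  ultimately show ?thesis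
    by (simp only: total_information_eq[OF \<theta> t] det_2 power2_eq_square vec_lambda_beta) (simp add: mult_ac)
qed

text \<open>\<open>C\<close> sends each layer weight to the corresponding gradient, so
  \<open>C\<close> after the derivative of \<open>mean_map\<close> is multiplication by the
  information matrix. The inverse derivative is thus \<open>matrix_inv ?I\<close> after
  \<open>C\<close>, and its values on the weights can be read off.\<close>

lemma inv_mean_map_has_derivative:
  assumes \<theta>: "\<theta> \<in> detector_params" and t: "0 < t" and k: "1 < k"
  obtains D where "(inv_into detector_params (mean_map k t) has_derivative D) (at (mean_map k t \<theta>))"
    and "\<And>i. D (layer_weight i) = matrix_inv (total_information k t \<theta>) *v log_mean_grad i \<theta>"
proof -
  let ?I = "total_information k t \<theta>"
  define C :: "real^2 \<Rightarrow> real^2" where "C y = vector [y$1 / \<theta>$1 - y$2 / (1 - \<theta>$1), y$1 / \<theta>$2]" for y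
  define D where "D y = matrix_inv ?I *v C y" for y
  let ?F = "\<lambda>h. \<Sum>i=1..k. (layer_mean t i \<theta> * (log_mean_grad i \<theta> \<bullet> h)) *\<^sub>R layer_weight i"
  have C_weight: "C (layer_weight i) = log_mean_grad i \<theta>" for i
    by (simp add: C_def layer_weight_def log_mean_grad_def)
  have lin: "linear C"
    by (rule linearI) (simp_all add: C_def vec_eq_iff forall_2 field_simps add_divide_distrib)
  have C_inj: "x = y" if "C x = C y" for x y
    using that \<theta> by (auto simp: C_def vec_eq_iff forall_2 detector_params_def)
  have "invertible ?I"
    using det_total_information_pos[OF \<theta> t k] by (simp add: invertible_det_nz)
  then have inv: "?I ** matrix_inv ?I = mat 1"
    unfolding invertible_def using matrix_inv_eqI by metis
  \<comment> \<open>As \<open>C\<close> is injective, \<open>?F (D y) = y\<close> may be checked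
    after applying \<open>C\<close>, where the sum becomes the information matrix.\<close>
  have "C (?F (D y)) = C y" for y
  proof -
    have "C (?F (D y)) = (\<Sum>i=1..k. (layer_mean t i \<theta> * (log_mean_grad i \<theta> \<bullet> D y)) *\<^sub>R log_mean_grad i \<theta>)"
      using lin by (simp add: linear_sum linear_scale C_weight)
    also have "\<dots> = ?I *v D y"
      by (simp add: total_information_mult_vec[OF \<theta> t])
    also have "\<dots> = C y"
      by (simp add: D_def matrix_vector_mul_assoc inv)
    finally show ?thesis .
  qed
  then have id: "?F \<circ> D = id"
    using C_inj by (auto simp: fun_eq_iff)
  have "(inv_into detector_params (mean_map k t) has_derivative D) (at (mean_map k t \<theta>))"
  proof (rule has_derivative_inverse_strong[OF open_detector_params \<theta> _ _ mean_map_has_derivative[OF \<theta>] id])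
    show "continuous_on detector_params (mean_map k t)"
      using mean_map_has_derivative
      by (intro continuous_at_imp_continuous_on ballI) (blast intro: has_derivative_continuous)
    show "inv_into detector_params (mean_map k t) (mean_map k t \<eta>) = \<eta>" if "\<eta> \<in> detector_params" for \<eta>
      using inj_on_mean_map[OF t k] that by (rule inv_into_f_f)
  qed
  then show ?thesis
    by (rule that) (simp add: D_def C_weight)
qed

text \<open>Openness is what makes a statistic converging to \<open>mean_map k t \<theta>\<close>
  enter the image, and thus the score equations solvable, from some round on.\<close>

lemma open_mean_map_image:
  assumes t: "0 < t" and k: "1 < k"
  shows "open (mean_map k t ` detector_params)"
proof (rule invariance_of_domain)
  show "continuous_on detector_params (mean_map k t)"
    using mean_map_has_derivative
    by (intro continuous_at_imp_continuous_on ballI) (blast intro: has_derivative_continuous)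
qed (use open_detector_params inj_on_mean_map[OF t k] in auto)

lemma inv_mean_map_measurable:
  assumes t: "0 < t" and k: "1 < k"
  shows "inv_into detector_params (mean_map k t) \<in> borel_measurable borel"
proof -
  let ?G = "inv_into detector_params (mean_map k t)"
  let ?U = "mean_map k t ` detector_params"
  \<comment> \<open>Off the image the defining predicate of \<open>inv_into\<close> is false at
    every candidate, so the choice is one constant there; the map is continuous on an open set and
    constant elsewhere.\<close>
  have G: "?G = (\<lambda>y. if y \<in> ?U then ?G y else (SOME x. False))"
    by (auto simp: fun_eq_iff inv_into_def image_iff intro!: arg_cong[where f = Eps])
  have "isCont ?G y" if y: "y \<in> ?U" for y
  proof -
    from y obtain \<theta> where "\<theta> \<in> detector_params" "y = mean_map k t \<theta>" by auto
    with inv_mean_map_has_derivative[OF this(1) t k] show ?thesis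
      by (metis has_derivative_continuous)
  qed
  then have "continuous_on ?U ?G"
    by (simp add: continuous_at_imp_continuous_on)
  then show ?thesis
    using open_mean_map_image[OF t k]
    by (subst G) (intro borel_measurable_continuous_on_if, auto)
qed

subsection \<open>Limits of functions of independent sequences\<close>

text \<open>The delta method for deterministic sequences. Stochastic convergence is replaced by
  pointwise convergence before it is applied, so an arbitrary convergent \<open>h\<close>
  suffices.\<close>

lemma has_derivative_rescaled_tendsto:
  fixes g :: "'a::real_normed_vector \<Rightarrow> 'b::real_normed_vector"
  assumes g: "(g has_derivative D) (at a)" and h: "h \<longlonglongrightarrow> l"
  shows "(\<lambda>n. sqrt (real n) *\<^sub>R (g (a + (1 / sqrt (real n)) *\<^sub>R h n) - g a)) \<longlonglongrightarrow> D l"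
proof (rule Lim_transform)
  interpret D: bounded_linear D
    using g by (rule has_derivative_bounded_linear)
  show "(\<lambda>n. D (h n)) \<longlonglongrightarrow> D l"
    by (rule D.tendsto[OF h])
  let ?y = "\<lambda>n. a + (1 / sqrt (real n)) *\<^sub>R h n"
  have "(\<lambda>n. (1 / sqrt (real n)) *\<^sub>R h n) \<longlonglongrightarrow> 0 *\<^sub>R l"
    by (intro tendsto_scaleR h) real_asymp
  then have "(\<lambda>n. ?y n - a) \<longlonglongrightarrow> 0"
    by (simp only: add_diff_cancel_left' scaleR_zero_left)
  then have y0: "(\<lambda>n. norm (?y n - a)) \<longlonglongrightarrow> 0"
    by (rule tendsto_norm_zero)
  show "(\<lambda>n. sqrt (real n) *\<^sub>R (g (?y n) - g a) - D (h n)) \<longlonglongrightarrow> 0"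
  proof (rule tendstoI)
    fix e :: real assume e: "0 < e"
    \<comment> \<open>Eventually \<open>norm (h n) < norm l + 1\<close>, so the remainder is at most
      \<open>e' * (norm l + 1)\<close>; the \<open>2\<close> makes this strictly less than
      \<open>e\<close>.\<close>
    define e' where "e' = e / (norm l + 2)"
    have "0 < norm l + 2"
      using norm_ge_zero[of l] by linarith
    then have e': "0 < e'" "e' * (norm l + 1) < e"
      using e by (simp_all add: e'_def field_simps)
    obtain d where d: "0 < d" "\<And>y. norm (y - a) < d \<Longrightarrow> norm (g y - g a - D (y - a)) \<le> e' * norm (y - a)"
      using g e'(1) unfolding has_derivative_at_alt by blast
    have "\<forall>\<^sub>F n in sequentially. norm (?y n - a) < d"
      using y0 d(1) by (rule order_tendstoD(2))
    moreover have "\<forall>\<^sub>F n in sequentially. norm (h n) < norm l + 1"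
      using tendsto_norm[OF h] by (rule order_tendstoD(2)) simp
    ultimately show "\<forall>\<^sub>F n in sequentially. dist (sqrt (real n) *\<^sub>R (g (?y n) - g a) - D (h n)) 0 < e"
      using eventually_gt_at_top[of 0]
    proof eventually_elim
      case (elim n)
      have eq: "sqrt (real n) *\<^sub>R (g (?y n) - g a) - D (h n) = sqrt (real n) *\<^sub>R (g (?y n) - g a - D (?y n - a))"
        using elim by (simp add: D.scaleR scaleR_diff_right)
      have "norm (sqrt (real n) *\<^sub>R (g (?y n) - g a) - D (h n)) \<le> sqrt (real n) * (e' * norm (?y n - a))"
        unfolding eq using mult_left_mono[OF d(2)[OF elim(1)], of "sqrt (real n)"]
        by (simp only: norm_scaleR abs_of_nonneg real_sqrt_ge_zero of_nat_0_le_iff)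
      also have "\<dots> = e' * norm (h n)"
        using elim by simp
      also have "\<dots> \<le> e' * (norm l + 1)"
        using elim e' by (intro mult_left_mono) auto
      finally show ?case
        using e' by simp
    qed
  qed
qed

lemma distr_PiM_coordinatewise:
  assumes I: "finite I" and M: "\<And>i. i \<in> I \<Longrightarrow> prob_space (M i)"
    and f [measurable]: "\<And>i. i \<in> I \<Longrightarrow> f i \<in> measurable (M i) (N i)"
  shows "distr (PiM I M) (PiM I N) (\<lambda>x. \<lambda>i\<in>I. f i (x i)) = PiM I (\<lambda>i. distr (M i) (N i) (f i))"
proof -
  \<comment> \<open>\<open>product_prob_space\<close> asks for a probability space at every index,
    so both families are completed by a point mass outside \<open>I\<close>, which leaves the
    product over \<open>I\<close> unchanged.\<close>
  define M' where "M' i = (if i \<in> I then M i else return (count_space UNIV) undefined)" for i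
  define N' where "N' i = (if i \<in> I then distr (M i) (N i) (f i) else return (count_space UNIV) undefined)" for i
  interpret M': product_prob_space M'
    using M by (intro product_prob_spaceI) (auto simp: M'_def prob_space_return)
  interpret N': product_prob_space N'
    using M f by (intro product_prob_spaceI) (auto simp: N'_def prob_space_return prob_space.prob_space_distr)
  have PM: "PiM I M = PiM I M'" by (intro PiM_cong) (auto simp: M'_def)
  have PN: "PiM I (\<lambda>i. distr (M i) (N i) (f i)) = PiM I N'" by (intro PiM_cong) (auto simp: N'_def)
  show ?thesis
    unfolding PN
  proof (rule N'.PiM_eqI[OF I])
    show "sets (distr (PiM I M) (PiM I N) (\<lambda>x. \<lambda>i\<in>I. f i (x i))) = sets (PiM I N')"
      by (auto simp: N'_def intro!: sets_PiM_cong)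
    fix A assume A: "\<And>i. i \<in> I \<Longrightarrow> A i \<in> sets (N' i)"
    then have A' [measurable]: "A i \<in> sets (N i)" if "i \<in> I" for i
      using that by (auto simp: N'_def)
    have "emeasure (distr (PiM I M) (PiM I N) (\<lambda>x. \<lambda>i\<in>I. f i (x i))) (Pi\<^sub>E I A)
        = emeasure (PiM I M) ((\<lambda>x. \<lambda>i\<in>I. f i (x i)) -` Pi\<^sub>E I A \<inter> space (PiM I M))"
      using I by (intro emeasure_distr sets_PiM_I_finite) (auto intro!: measurable_restrict)
    also have "(\<lambda>x. \<lambda>i\<in>I. f i (x i)) -` Pi\<^sub>E I A \<inter> space (PiM I M) = Pi\<^sub>E I (\<lambda>i. f i -` A i \<inter> space (M i))"
      by (auto simp: space_PiM PiE_iff)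
    also have "emeasure (PiM I M) \<dots> = (\<Prod>i\<in>I. emeasure (M i) (f i -` A i \<inter> space (M i)))"
      unfolding PM using I by (subst M'.emeasure_PiM) (auto simp: M'_def intro!: prod.cong)
    also have "\<dots> = (\<Prod>i\<in>I. emeasure (N' i) (A i))"
      by (intro prod.cong refl) (simp add: N'_def emeasure_distr)
    finally show "emeasure (distr (PiM I M) (PiM I N) (\<lambda>x. \<lambda>i\<in>I. f i (x i))) (Pi\<^sub>E I A) = (\<Prod>i\<in>I. emeasure (N' i) (A i))" .
  qed
qed

text \<open>Continuous mapping for products of weakly convergent laws: Skorohod's theorem applied in each
  coordinate turns weak convergence into pointwise convergence on a product space.\<close>

lemma weak_conv_PiM_integral:
  fixes \<mu> :: "'i \<Rightarrow> nat \<Rightarrow> real measure" and g :: "nat \<Rightarrow> ('i \<Rightarrow> real) \<Rightarrow> real"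
  assumes I: "finite I" and \<mu>: "\<And>i n. i \<in> I \<Longrightarrow> real_distribution (\<mu> i n)"
    and \<nu>: "\<And>i. i \<in> I \<Longrightarrow> real_distribution (\<nu> i)"
    and conv: "\<And>i. i \<in> I \<Longrightarrow> weak_conv_m (\<mu> i) (\<nu> i)"
    and g [measurable]: "\<And>n. g n \<in> borel_measurable (PiM I (\<lambda>_. borel))"
    and G [measurable]: "G \<in> borel_measurable (PiM I (\<lambda>_. borel))"
    and bound: "\<And>n x. \<bar>g n x\<bar> \<le> B"
    and lim: "\<And>y l. (\<And>i. i \<in> I \<Longrightarrow> (\<lambda>n. y n i) \<longlonglongrightarrow> l i) \<Longrightarrow> (\<lambda>n. g n (y n)) \<longlonglongrightarrow> G l"
  shows "(\<lambda>n. \<integral>x. g n x \<partial>PiM I (\<lambda>i. \<mu> i n)) \<longlonglongrightarrow> (\<integral>x. G x \<partial>PiM I \<nu>)"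
proof -
  \<comment> \<open>Collects the conclusion of Skorohod's theorem in one predicate, so that spaces
    and variables can be chosen for all indices at once.\<close>
  define Q :: "'i \<Rightarrow> real measure \<Rightarrow> (nat \<Rightarrow> real \<Rightarrow> real) \<Rightarrow> (real \<Rightarrow> real) \<Rightarrow> bool" where
    "Q i \<Omega> Z Y \<longleftrightarrow> prob_space \<Omega> \<and> (\<forall>n. Z n \<in> borel_measurable \<Omega>) \<and>
      (\<forall>n. distr \<Omega> borel (Z n) = \<mu> i n) \<and> Y \<in> borel_measurable \<Omega> \<and> distr \<Omega> borel Y = \<nu> i \<and>
      (\<forall>x\<in>space \<Omega>. (\<lambda>n. Z n x) \<longlonglongrightarrow> Y x)" for i \<Omega> Z Y
  have "\<exists>\<Omega> Z Y. Q i \<Omega> Z Y" if "i \<in> I" for i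
    using Skorohod[OF \<mu>[OF that] \<nu>[OF that] conv[OF that]] by (simp add: Q_def)
  then obtain \<Omega> Z Y where "\<And>i. i \<in> I \<Longrightarrow> Q i (\<Omega> i) (Z i) (Y i)"
    by metis
  then have ps: "\<And>i. i \<in> I \<Longrightarrow> prob_space (\<Omega> i)"
    and Z [measurable]: "\<And>i n. i \<in> I \<Longrightarrow> Z i n \<in> borel_measurable (\<Omega> i)"
    and Zd: "\<And>i n. i \<in> I \<Longrightarrow> distr (\<Omega> i) borel (Z i n) = \<mu> i n"
    and Y [measurable]: "\<And>i. i \<in> I \<Longrightarrow> Y i \<in> borel_measurable (\<Omega> i)"
    and Yd: "\<And>i. i \<in> I \<Longrightarrow> distr (\<Omega> i) borel (Y i) = \<nu> i"
    and ZY: "\<And>i x. i \<in> I \<Longrightarrow> x \<in> space (\<Omega> i) \<Longrightarrow> (\<lambda>n. Z i n x) \<longlonglongrightarrow> Y i x"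
    unfolding Q_def by auto
  let ?P = "PiM I \<Omega>"
  interpret P: prob_space ?P
    using ps by (rule prob_space_PiM)
  have Zm [measurable]: "(\<lambda>x. \<lambda>i\<in>I. Z i n (x i)) \<in> measurable ?P (PiM I (\<lambda>_. borel))" for n
    by (intro measurable_restrict) measurable
  have Ym [measurable]: "(\<lambda>x. \<lambda>i\<in>I. Y i (x i)) \<in> measurable ?P (PiM I (\<lambda>_. borel))"
    by (intro measurable_restrict) measurable
  \<comment> \<open>Skorohod's theorem controls each marginal only; the product of the coordinate
    spaces makes the copies independent and so restores the joint laws.\<close>
  have \<mu>P: "PiM I (\<lambda>i. \<mu> i n) = distr ?P (PiM I (\<lambda>_. borel)) (\<lambda>x. \<lambda>i\<in>I. Z i n (x i))" for n
    using distr_PiM_coordinatewise[OF I ps Z] Zd by (simp cong: PiM_cong)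
  have \<nu>P: "PiM I \<nu> = distr ?P (PiM I (\<lambda>_. borel)) (\<lambda>x. \<lambda>i\<in>I. Y i (x i))"
    using distr_PiM_coordinatewise[OF I ps Y] Yd by (simp cong: PiM_cong)
  have "(\<lambda>n. \<integral>x. g n (\<lambda>i\<in>I. Z i n (x i)) \<partial>?P) \<longlonglongrightarrow> (\<integral>x. G (\<lambda>i\<in>I. Y i (x i)) \<partial>?P)"
  proof (rule integral_dominated_convergence[where w = "\<lambda>_. B"])
    show "AE x in ?P. (\<lambda>n. g n (\<lambda>i\<in>I. Z i n (x i))) \<longlonglongrightarrow> G (\<lambda>i\<in>I. Y i (x i))"
      using ZY by (intro AE_I2 lim) (auto simp: space_PiM)
  qed (use bound in auto)
  then show ?thesis
    unfolding \<mu>P \<nu>P by (simp add: integral_distr)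
qed

subsection \<open>The estimator\<close>

locale layered_counts = prob_space M for M :: "'a measure" +
  fixes X :: "nat \<Rightarrow> nat \<Rightarrow> 'a \<Rightarrow> nat" and k :: nat and t :: real and \<theta> :: "real^2"
  assumes k: "1 < k" and t: "0 < t" and \<theta>: "\<theta> \<in> detector_params"
    and indep: "indep_vars (\<lambda>_. count_space UNIV) (\<lambda>(i, j). X i j) ({1..k} \<times> {1..})"
    and dist: "\<And>i j. i \<in> {1..k} \<Longrightarrow> j \<ge> 1 \<Longrightarrow>
      distr M (count_space UNIV) (X i j) = measure_pmf (poisson_pmf (layer_mean t i \<theta>))"
begin

abbreviation m :: "nat \<Rightarrow> real" where "m i \<equiv> layer_mean t i \<theta>"

lemma m_pos: "0 < m i"
  using layer_mean_pos[OF \<theta> t] .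

text \<open>Rounds of \<open>X\<close> are numbered from \<open>1\<close>; the shift by
  \<open>Suc\<close> makes sums over \<open>j < n\<close> run over exactly the first
  \<open>n\<close> rounds.\<close>

definition centered :: "nat \<Rightarrow> nat \<Rightarrow> 'a \<Rightarrow> real" where
  "centered i j \<omega> = real (X i (Suc j) \<omega>) - m i"

text \<open>Normalised to unit variance for \<open>n > 0\<close>, so that every layer has the same
  limit; the factor \<open>sqrt (m i)\<close> reappears in the coefficients of the linear
  combination.\<close>

definition fluctuation :: "nat \<Rightarrow> nat \<Rightarrow> 'a \<Rightarrow> real" where
  "fluctuation i n \<omega> = (\<Sum>j<n. centered i j \<omega>) / sqrt (real n * m i)"

definition statistic :: "nat \<Rightarrow> 'a \<Rightarrow> real^2" where
  "statistic n \<omega> = vector [mean_count k n (\<lambda>i j. X i j \<omega>), mean_weighted_count k n (\<lambda>i j. X i j \<omega>)]"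

section \<open>Probabilistic properties of the centred counts\<close>

lemma X_measurable: "i \<in> {1..k} \<Longrightarrow> j \<ge> 1 \<Longrightarrow> X i j \<in> measurable M (count_space UNIV)"
  using indep unfolding indep_vars_def by auto

lemma centered_measurable: "i \<in> {1..k} \<Longrightarrow> centered i j \<in> borel_measurable M"
  unfolding centered_def using measurable_compose[OF X_measurable, of i "Suc j" "\<lambda>x. real x - m i" borel] by simp

lemma fluctuation_measurable: "i \<in> {1..k} \<Longrightarrow> fluctuation i n \<in> borel_measurable M"
  using centered_measurable[of i] unfolding fluctuation_def by measurable

lemma indep_centered:
  assumes i: "i \<in> {1..k}"
  shows "indep_vars (\<lambda>_. borel) (centered i) UNIV"
proof -
  have "indep_vars (\<lambda>_. count_space UNIV) (\<lambda>j. (\<lambda>(i, j). X i j) (i, Suc j)) UNIV"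
    using i by (intro indep_vars_reindex[OF indep]) (auto simp: inj_on_def)
  then have "indep_vars (\<lambda>_. count_space UNIV) (\<lambda>j. X i (Suc j)) UNIV"
    by simp
  then have "indep_vars (\<lambda>_. borel) (\<lambda>j \<omega>. real (X i (Suc j) \<omega>) - m i) UNIV"
    by (rule indep_vars_compose2) auto
  then show ?thesis
    by (simp add: centered_def[abs_def])
qed

lemma distr_centered:
  assumes i: "i \<in> {1..k}"
  shows "distr M borel (centered i j) = distr (measure_pmf (poisson_pmf (m i))) borel (\<lambda>x. real x - m i)"
proof -
  have "distr M borel (centered i j) = distr (distr M (count_space UNIV) (X i (Suc j))) borel (\<lambda>x. real x - m i)"
    using X_measurable[OF i, of "Suc j"] by (subst distr_distr) (auto simp: comp_def centered_def[abs_def])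
  then show ?thesis
    using dist[OF i, of "Suc j"] by simp
qed

lemma has_bochner_integral_centered:
  assumes i: "i \<in> {1..k}" and g [measurable]: "g \<in> borel_measurable borel"
    and int: "has_bochner_integral (measure_pmf (poisson_pmf (m i))) (\<lambda>x. g (real x - m i)) (s :: real)"
  shows "has_bochner_integral M (\<lambda>\<omega>. g (centered i j \<omega>)) s"
proof -
  note [measurable] = centered_measurable[OF i]
  have "has_bochner_integral (distr M borel (centered i j)) g s"
    unfolding distr_centered[OF i] using int
    by (simp add: has_bochner_integral_iff integrable_distr_eq integral_distr)
  then show ?thesis
    by (simp add: has_bochner_integral_iff integrable_distr_eq integral_distr)
qed

text \<open>By \<open>exp a - 1 - a \<le> a\<^sup>2\<close> on \<open>[-1, 1]\<close>, the layer
  mean itself serves as the constant in the subexponential bound.\<close>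

lemma centered_law_of_large_numbers:
  assumes i: "i \<in> {1..k}"
  shows "AE \<omega> in M. (\<lambda>n. (\<Sum>j<n. centered i j \<omega>) / real n) \<longlonglongrightarrow> 0"
proof (rule strong_law_subexponential[OF indep_centered[OF i] m_pos])
  note [measurable] = centered_measurable[OF i]
  fix a :: real and j assume a: "\<bar>a\<bar> \<le> 1"
  have "(\<integral>\<^sup>+\<omega>. ennreal (exp (a * centered i j \<omega>)) \<partial>M) = (\<integral>\<^sup>+y. ennreal (exp (a * y)) \<partial>distr M borel (centered i j))"
    by (subst nn_integral_distr) auto
  also have "\<dots> = ennreal (exp (m i * (exp a - 1 - a)))"
    unfolding distr_centered[OF i] nn_integral_poisson_exp[OF m_pos, symmetric]
    by (subst nn_integral_distr) auto
  also have "\<dots> \<le> ennreal (exp (m i * a\<^sup>2))"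
    using m_pos[of i] exp_le_quadratic[OF a] by (intro ennreal_leI) simp
  finally show "(\<integral>\<^sup>+\<omega>. ennreal (exp (a * centered i j \<omega>)) \<partial>M) \<le> ennreal (exp (m i * a\<^sup>2))" .
qed

lemma fluctuation_weak_conv:
  assumes i: "i \<in> {1..k}"
  shows "weak_conv_m (\<lambda>n. distr M borel (fluctuation i n)) std_normal_distribution"
proof -
  have mean: "has_bochner_integral M (centered i j) 0" for j
  proof (rule has_bochner_integral_centered[OF i, of "\<lambda>y. y", simplified])
    have "has_bochner_integral (measure_pmf (poisson_pmf (m i))) (\<lambda>x. real x - m i) (m i - m i)"
      by (intro has_bochner_integral_diff has_bochner_integral_poisson_mean m_pos)
        (simp add: has_bochner_integral_iff measure_pmf.prob_space)
    then show "has_bochner_integral (measure_pmf (poisson_pmf (m i))) (\<lambda>x. real x - m i) 0"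
      by simp
  qed
  have var: "has_bochner_integral M (\<lambda>\<omega>. (centered i j \<omega>)\<^sup>2) (m i)" for j
    by (rule has_bochner_integral_centered[OF i, of "\<lambda>y. y\<^sup>2"])
      (auto intro: has_bochner_integral_poisson_variance m_pos)
  \<comment> \<open>A Poisson variance equals its mean, so the standard deviation entering the
    central limit theorem is \<open>sqrt (m i)\<close>.\<close>
  have "weak_conv_m (\<lambda>n. distr M borel (\<lambda>\<omega>. (\<Sum>j<n. centered i j \<omega>) / sqrt (real n * (sqrt (m i))\<^sup>2)))
      std_normal_distribution"
  proof (rule central_limit_theorem_zero_mean[OF indep_centered[OF i]])
    show "expectation (centered i j) = 0" for j
      using mean[of j] by (simp add: has_bochner_integral_iff)
    show "integrable M (\<lambda>\<omega>. (centered i j \<omega>)\<^sup>2)" for j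
      using var[of j] by (simp add: has_bochner_integral_iff)
    show "variance (centered i j) = (sqrt (m i))\<^sup>2" for j
      using mean[of j] var[of j] m_pos[of i] by (simp add: has_bochner_integral_iff)
    show "0 < sqrt (m i)"
      using m_pos by simp
    show "distr M borel (centered i j) = distr (measure_pmf (poisson_pmf (m i))) borel (\<lambda>x. real x - m i)" for j
      by (rule distr_centered[OF i])
  qed
  then show ?thesis
    using m_pos[of i] by (simp add: fluctuation_def[abs_def])
qed

text \<open>The fluctuation of layer \<open>i\<close> is a function of the block
  \<open>{i} \<times> {1..n}\<close> of the array, and blocks of different layers are
  disjoint.\<close>

lemma indep_fluctuation: "indep_vars (\<lambda>_. borel) (\<lambda>i. fluctuation i n) {1..k}"
proof -
  let ?K = "\<lambda>i. {i} \<times> {1..n}"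
  let ?g = "\<lambda>i f. (\<Sum>j<n. real (f (i, Suc j)) - m i) / sqrt (real n * m i)"
  have "indep_vars (\<lambda>i. PiM (?K i) (\<lambda>_. count_space UNIV)) (\<lambda>i \<omega>. restrict (\<lambda>ij. (case ij of (i, j) \<Rightarrow> X i j) \<omega>) (?K i)) {1..k}"
    by (rule indep_vars_restrict[OF indep]) (auto simp: disjoint_family_on_def)
  then have "indep_vars (\<lambda>_. borel) (\<lambda>i \<omega>. ?g i (restrict (\<lambda>ij. (case ij of (i, j) \<Rightarrow> X i j) \<omega>) (?K i))) {1..k}"
  proof (rule indep_vars_compose2)
    fix i :: nat
    have [measurable]: "(\<lambda>f. real (f (i, Suc j))) \<in> borel_measurable (PiM (?K i) (\<lambda>_. count_space UNIV))" if "j < n" for j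
      using that by (intro measurable_compose[OF measurable_component_singleton]) auto
    show "?g i \<in> borel_measurable (PiM (?K i) (\<lambda>_. count_space UNIV))"
      by (intro borel_measurable_divide borel_measurable_sum borel_measurable_diff) (auto simp del: One_nat_def)
  qed
  moreover have "?g i (restrict (\<lambda>ij. (case ij of (i, j) \<Rightarrow> X i j) \<omega>) (?K i)) = fluctuation i n \<omega>" for i \<omega>
    by (simp add: fluctuation_def centered_def)
  ultimately show ?thesis
    by simp
qed

lemma statistic_eq_centered:
  assumes n: "0 < n"
  shows "statistic n \<omega> = mean_map k t \<theta> + (\<Sum>i=1..k. ((\<Sum>j<n. centered i j \<omega>) / real n) *\<^sub>R layer_weight i)"
proof -
  \<comment> \<open>Stated for arbitrary coefficients, since both averages are instances:
    \<open>c = 1\<close> for the first and \<open>c i = real i - 1\<close> for the second.\<close>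
  have swap: "(\<Sum>j=1..n. \<Sum>i=1..k. c i * real (X i j \<omega>)) / real n
      = (\<Sum>i=1..k. c i * m i) + (\<Sum>i=1..k. (\<Sum>j<n. centered i j \<omega>) / real n * c i)" for c :: "nat \<Rightarrow> real"
  proof -
    have "(\<Sum>j=1..n. real (X i j \<omega>)) = (\<Sum>j<n. centered i j \<omega>) + real n * m i" for i
      by (simp add: centered_def sum_subtractf sum.atLeast1_atMost_eq)
    then have "c i * (\<Sum>j=1..n. real (X i j \<omega>)) / real n = c i * m i + (\<Sum>j<n. centered i j \<omega>) / real n * c i" for i
      using n by (simp add: add_divide_distrib distrib_left mult.commute)
    then have "(\<Sum>i=1..k. c i * (\<Sum>j=1..n. real (X i j \<omega>))) / real n
        = (\<Sum>i=1..k. c i * m i + (\<Sum>j<n. centered i j \<omega>) / real n * c i)"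
      by (simp only: sum_divide_distrib)
    moreover have "(\<Sum>j=1..n. \<Sum>i=1..k. c i * real (X i j \<omega>)) = (\<Sum>i=1..k. c i * (\<Sum>j=1..n. real (X i j \<omega>)))"
      by (subst sum.swap) (simp add: sum_distrib_left)
    ultimately show ?thesis by (simp add: sum.distrib)
  qed
  show ?thesis
    using swap[of "\<lambda>_. 1"] swap[of "\<lambda>i. real i - 1"]
    by (simp add: vec_eq_iff forall_2 statistic_def mean_count_def mean_weighted_count_def mean_map_def
        layer_weight_def mult.commute)
qed

lemma statistic_eq_fluctuation:
  assumes n: "0 < n"
  shows "statistic n \<omega> = mean_map k t \<theta> +
    (1 / sqrt (real n)) *\<^sub>R (\<Sum>i=1..k. (sqrt (m i) * fluctuation i n \<omega>) *\<^sub>R layer_weight i)"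
proof -
  have "(\<Sum>j<n. centered i j \<omega>) / real n = 1 / sqrt (real n) * (sqrt (m i) * fluctuation i n \<omega>)" for i
  proof -
    have "sqrt (real n) * sqrt (real n) = real n" by simp
    then show ?thesis
      using n m_pos[of i] by (simp add: fluctuation_def real_sqrt_mult field_simps)
  qed
  then show ?thesis
    by (simp add: statistic_eq_centered[OF n] scaleR_sum_right)
qed

lemma statistic_law_of_large_numbers: "AE \<omega> in M. (\<lambda>n. statistic n \<omega>) \<longlonglongrightarrow> mean_map k t \<theta>"
proof -
  have "AE \<omega> in M. \<forall>i\<in>{1..k}. (\<lambda>n. (\<Sum>j<n. centered i j \<omega>) / real n) \<longlonglongrightarrow> 0"
    using centered_law_of_large_numbers by (intro AE_finite_allI) auto
  then show ?thesis
  proof (rule AE_mp, intro AE_I2 impI)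
    fix \<omega> assume "\<forall>i\<in>{1..k}. (\<lambda>n. (\<Sum>j<n. centered i j \<omega>) / real n) \<longlonglongrightarrow> 0"
    then have "(\<lambda>n. mean_map k t \<theta> + (\<Sum>i=1..k. ((\<Sum>j<n. centered i j \<omega>) / real n) *\<^sub>R layer_weight i))
        \<longlonglongrightarrow> mean_map k t \<theta> + (\<Sum>i=1..k. 0 *\<^sub>R layer_weight i)"
      by (intro tendsto_intros) auto
    then have "(\<lambda>n. mean_map k t \<theta> + (\<Sum>i=1..k. ((\<Sum>j<n. centered i j \<omega>) / real n) *\<^sub>R layer_weight i))
        \<longlonglongrightarrow> mean_map k t \<theta>"
      by simp
    moreover have "\<forall>\<^sub>F n in sequentially. mean_map k t \<theta> + (\<Sum>i=1..k. ((\<Sum>j<n. centered i j \<omega>) / real n) *\<^sub>R layer_weight i) = statistic n \<omega>"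
      using eventually_gt_at_top[of 0] by eventually_elim (simp add: statistic_eq_centered)
    ultimately show "(\<lambda>n. statistic n \<omega>) \<longlonglongrightarrow> mean_map k t \<theta>"
      by (rule Lim_transform_eventually)
  qed
qed

text \<open>Membership in the image gives existence of a solution and injectivity gives uniqueness,
  so the singleton clause of \<open>is_mle\<close> fixes the estimator.\<close>

lemma mle_eq:
  assumes est: "is_mle M k t X n est" and \<omega>: "\<omega> \<in> space M"
    and stat: "statistic n \<omega> \<in> mean_map k t ` detector_params"
  shows "est \<omega> = inv_into detector_params (mean_map k t) (statistic n \<omega>)"
proof -
  let ?\<eta> = "inv_into detector_params (mean_map k t) (statistic n \<omega>)"
  have "score_solutions k t n (\<lambda>i j. X i j \<omega>) = {\<eta> \<in> detector_params. mean_map k t \<eta> = statistic n \<omega>}"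
    by (simp add: score_solutions_eq[OF t] statistic_def)
  also have "\<dots> = {?\<eta>}"
    using stat inj_on_mean_map[OF t k] by (auto simp: inv_into_into f_inv_into_f inv_into_f_f dest: inj_onD)
  finally show ?thesis
    using est \<omega> by (auto simp: is_mle_def)
qed

lemma AE_eventually_mle_eq:
  assumes est: "\<And>n. n \<ge> 1 \<Longrightarrow> is_mle M k t X n (est n)"
  shows "AE \<omega> in M. \<forall>\<^sub>F n in sequentially. est n \<omega> = inv_into detector_params (mean_map k t) (statistic n \<omega>)"
  using statistic_law_of_large_numbers
proof (rule AE_mp, intro AE_I2 impI)
  fix \<omega> assume \<omega>: "\<omega> \<in> space M" and "(\<lambda>n. statistic n \<omega>) \<longlonglongrightarrow> mean_map k t \<theta>"
  then have "\<forall>\<^sub>F n in sequentially. statistic n \<omega> \<in> mean_map k t ` detector_params"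
    using open_mean_map_image[OF t k] \<theta> by (intro topological_tendstoD) auto
  then show "\<forall>\<^sub>F n in sequentially. est n \<omega> = inv_into detector_params (mean_map k t) (statistic n \<omega>)"
    using eventually_ge_at_top[of 1] by eventually_elim (use est mle_eq \<omega> in auto)
qed

section \<open>Consistency and the limit law\<close>

lemma mle_consistent:
  assumes est: "\<And>n. n \<ge> 1 \<Longrightarrow> is_mle M k t X n (est n)"
  shows "AE \<omega> in M. (\<lambda>n. est n \<omega>) \<longlonglongrightarrow> \<theta>"
proof -
  have "AE \<omega> in M. \<forall>\<^sub>F n in sequentially. est n \<omega> = inv_into detector_params (mean_map k t) (statistic n \<omega>)"
    by (rule AE_eventually_mle_eq[OF est])
  with statistic_law_of_large_numbers show ?thesis
  proof eventually_elim
    case (elim \<omega>)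
    let ?G = "inv_into detector_params (mean_map k t)"
    obtain D where "(?G has_derivative D) (at (mean_map k t \<theta>))"
      using inv_mean_map_has_derivative[OF \<theta> t k] by blast
    then have "isCont ?G (mean_map k t \<theta>)"
      by (rule has_derivative_continuous)
    then have "(\<lambda>n. ?G (statistic n \<omega>)) \<longlonglongrightarrow> ?G (mean_map k t \<theta>)"
      using elim(1) by (rule isCont_tendsto_compose)
    also have "?G (mean_map k t \<theta>) = \<theta>"
      using inj_on_mean_map[OF t k] \<theta> by (rule inv_into_f_f)
    finally have "(\<lambda>n. ?G (statistic n \<omega>)) \<longlonglongrightarrow> \<theta>" .
    moreover have "\<forall>\<^sub>F n in sequentially. ?G (statistic n \<omega>) = est n \<omega>"
      using elim(2) by eventually_elim simp
    ultimately show ?case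
      by (rule Lim_transform_eventually)
  qed
qed

lemma statistic_measurable: "statistic n \<in> borel_measurable M"
proof (cases "n = 0")
  case True
  then show ?thesis by (simp add: statistic_def[abs_def] mean_count_def mean_weighted_count_def)
next
  case False
  then have "statistic n = (\<lambda>\<omega>. mean_map k t \<theta> + (\<Sum>i=1..k. ((\<Sum>j<n. centered i j \<omega>) / real n) *\<^sub>R layer_weight i))"
    by (auto simp: statistic_eq_centered)
  then show ?thesis
    using centered_measurable
    by (auto intro!: borel_measurable_add borel_measurable_sum borel_measurable_scaleR borel_measurable_divide)
qed

text \<open>The covariance of the linearised estimator is
  \<open>I\<^sup>-\<^sup>1 (\<Sum>\<^sub>i m\<^sub>i u\<^sub>i u\<^sub>i\<^sup>T) I\<^sup>-\<^sup>1\<close> with \<open>u\<^sub>i\<close> the gradient of \<open>ln m\<^sub>i\<close>.\<close>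

lemma covariance_eq_matrix_inv:
  defines "B \<equiv> matrix_inv (total_information k t \<theta>)"
  shows "(\<chi> a b. \<Sum>i=1..k. (sqrt (m i) *\<^sub>R (B *v log_mean_grad i \<theta>)) $ a * (sqrt (m i) *\<^sub>R (B *v log_mean_grad i \<theta>)) $ b) = B"
proof -
  let ?I = "total_information k t \<theta>" and ?u = "\<lambda>i. log_mean_grad i \<theta>"
  have "invertible ?I"
    using det_total_information_pos[OF \<theta> t k] by (simp add: invertible_det_nz)
  then have inv: "?I ** B = mat 1"
    unfolding B_def invertible_def using matrix_inv_eqI by metis
  then have inv': "B ** ?I = mat 1"
    by (simp add: matrix_left_right_inverse)
  have I_sym: "transpose ?I = ?I"
    by (simp add: total_information_eq[OF \<theta> t] transpose_def vec_eq_iff mult_ac)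
  \<comment> \<open>Transposing the left inverse identity exhibits \<open>transpose B\<close> as a
    right inverse of the symmetric matrix \<open>?I\<close>; uniqueness makes \<open>B\<close>
    symmetric.\<close>
  have "?I ** transpose B = mat 1"
    using arg_cong[OF inv', of transpose] by (simp add: matrix_transpose_mul I_sym transpose_mat)
  then have B_sym: "transpose B = B"
    unfolding B_def by (metis matrix_inv_eqI)
  have "(\<Sum>i=1..k. (sqrt (m i) *\<^sub>R (B *v ?u i)) $ a * (sqrt (m i) *\<^sub>R (B *v ?u i)) $ b) = (B ** (?I ** transpose B)) $ a $ b" for a b
  proof -
    have "(sqrt (m i) *\<^sub>R (B *v ?u i)) $ a * (sqrt (m i) *\<^sub>R (B *v ?u i)) $ b = m i * ((B *v ?u i) $ a * (B *v ?u i) $ b)" for i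
    proof -
      have "(sqrt (m i) *\<^sub>R (B *v ?u i)) $ a * (sqrt (m i) *\<^sub>R (B *v ?u i)) $ b
          = (sqrt (m i) * sqrt (m i)) * ((B *v ?u i) $ a * (B *v ?u i) $ b)"
        by simp
      then show ?thesis
        using m_pos[of i] by (simp only: real_sqrt_mult_self abs_of_pos)
    qed
    moreover have "(\<Sum>i=1..k. m i * ((B *v ?u i) $ a * (B *v ?u i) $ b)) = (B ** (?I ** transpose B)) $ a $ b"
      by (simp add: total_information_eq[OF \<theta> t] matrix_matrix_mult_def matrix_vector_mult_def transpose_def sum_2
          sum_distrib_left sum_distrib_right sum.distrib[symmetric] algebra_simps)
    ultimately show ?thesis by (simp only:)
  qed
  then show ?thesis
    using inv B_sym by (simp add: vec_eq_iff matrix_mul_rid)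
qed

text \<open>Stated for the inverse map rather than the estimator, because its value at the statistic
  is, for \<open>n > 0\<close>, an exact measurable function of the independent
  fluctuations.\<close>

lemma inv_statistic_asymptotically_normal:
  fixes f :: "real^2 \<Rightarrow> real"
  assumes f: "continuous_on UNIV f" and fB: "\<And>x. \<bar>f x\<bar> \<le> B"
  shows "(\<lambda>n. \<integral>\<omega>. f (sqrt (real n) *\<^sub>R (inv_into detector_params (mean_map k t) (statistic n \<omega>) - \<theta>)) \<partial>M)
    \<longlonglongrightarrow> (\<integral>x. f x \<partial>multivariate_normal 0 (matrix_inv (total_information k t \<theta>)))"
proof -
  let ?G = "inv_into detector_params (mean_map k t)" and ?a = "mean_map k t \<theta>"
  let ?I = "total_information k t \<theta>" and ?u = "\<lambda>i. log_mean_grad i \<theta>"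
  let ?w = "\<lambda>i. sqrt (m i) *\<^sub>R (matrix_inv ?I *v ?u i)"
  let ?N = "density lborel std_normal_density"
  obtain D where D: "(?G has_derivative D) (at ?a)" and Dw: "\<And>i. D (layer_weight i) = matrix_inv ?I *v ?u i"
    using inv_mean_map_has_derivative[OF \<theta> t k] by blast
  interpret D: bounded_linear D
    using D by (rule has_derivative_bounded_linear)
  have Ga: "?G ?a = \<theta>"
    using inj_on_mean_map[OF t k] \<theta> by (rule inv_into_f_f)
  have [measurable]: "f \<in> borel_measurable borel"
    using f by (rule borel_measurable_continuous_onI)
  note [measurable] = inv_mean_map_measurable[OF t k]
  \<comment> \<open>At the vector of fluctuations this is \<open>sqrt n\<close> times the deviation
    of the statistic from \<open>mean_map k t \<theta>\<close>.\<close>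
  define L :: "(nat \<Rightarrow> real) \<Rightarrow> real^2" where "L y = (\<Sum>i=1..k. (sqrt (m i) * y i) *\<^sub>R layer_weight i)" for y
  have [measurable]: "L \<in> borel_measurable (PiM {1..k} (\<lambda>_. borel))"
    unfolding L_def by (intro borel_measurable_sum borel_measurable_scaleR borel_measurable_times) auto
  define g where "g n y = f (sqrt (real n) *\<^sub>R (?G (?a + (1 / sqrt (real n)) *\<^sub>R L y) - ?G ?a))" for n y
  have g_meas [measurable]: "g n \<in> borel_measurable (PiM {1..k} (\<lambda>_. borel))" for n
    unfolding g_def by measurable
  have DL: "D (L y) = (\<Sum>i\<in>{1..k}. y i *\<^sub>R ?w i)" for y
    unfolding L_def by (simp add: D.sum D.scaleR Dw mult.commute)
  have Gm: "(\<lambda>y. f (D (L y))) \<in> borel_measurable (PiM {1..k} (\<lambda>_. borel))"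
    unfolding DL by measurable
  have std: "real_distribution ?N"
    using prob_space_std_normal by (auto simp: real_distribution_def real_distribution_axioms_def)
  have "(\<lambda>n. \<integral>y. g n y \<partial>PiM {1..k} (\<lambda>i. distr M borel (fluctuation i n)))
      \<longlonglongrightarrow> (\<integral>y. f (D (L y)) \<partial>PiM {1..k} (\<lambda>_. ?N))"
  proof (rule weak_conv_PiM_integral[where B = B])
    show "real_distribution (distr M borel (fluctuation i n))" if "i \<in> {1..k}" for i n
      using fluctuation_measurable[OF that] by (rule real_distribution_distr)
    show "(\<lambda>n. g n (y n)) \<longlonglongrightarrow> f (D (L l))" if "\<And>i. i \<in> {1..k} \<Longrightarrow> (\<lambda>n. y n i) \<longlonglongrightarrow> l i" for y l
    proof -
      have "(\<lambda>n. L (y n)) \<longlonglongrightarrow> L l"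
        unfolding L_def using that by (intro tendsto_intros) auto
      then have "(\<lambda>n. sqrt (real n) *\<^sub>R (?G (?a + (1 / sqrt (real n)) *\<^sub>R L (y n)) - ?G ?a)) \<longlonglongrightarrow> D (L l)"
        by (rule has_derivative_rescaled_tendsto[OF D])
      moreover have "isCont f (D (L l))"
        using f by (simp add: continuous_on_eq_continuous_at)
      ultimately show ?thesis
        unfolding g_def by (rule isCont_tendsto_compose[rotated])
    qed
  qed (use std fluctuation_weak_conv fB Gm g_meas in \<open>auto simp: g_def[abs_def]\<close>)
  moreover have "(\<integral>y. f (D (L y)) \<partial>PiM {1..k} (\<lambda>_. ?N)) = (\<integral>x. f x \<partial>multivariate_normal 0 (matrix_inv ?I))"
  proof -
    \<comment> \<open>Multiplicativity of the determinant: the invertible matrix and the positive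
      scalings preserve the independence of the first two gradients.\<close>
    have "?w 1 $ 1 * ?w 2 $ 2 - ?w 2 $ 1 * ?w 1 $ 2 = sqrt (m 1) * sqrt (m 2) * det (matrix_inv ?I) *
        (?u 1 $ 1 * ?u 2 $ 2 - ?u 2 $ 1 * ?u 1 $ 2)"
      by (simp add: det_2 matrix_vector_mult_def sum_2 algebra_simps)
    moreover have "det (matrix_inv ?I) \<noteq> 0"
    proof -
      have "invertible ?I"
        using det_total_information_pos[OF \<theta> t k] by (simp add: invertible_det_nz)
      then have "?I ** matrix_inv ?I = mat 1"
        unfolding invertible_def using matrix_inv_eqI by metis
      then have "det ?I * det (matrix_inv ?I) = 1"
        by (metis det_I det_mul)
      then show ?thesis by auto
    qed
    ultimately have "?w 1 $ 1 * ?w 2 $ 2 - ?w 2 $ 1 * ?w 1 $ 2 \<noteq> 0"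
      using m_pos[of 1] m_pos[of 2] log_mean_grad_independent[OF \<theta>] by simp
    then have w: "distr (PiM {1..k} (\<lambda>_. ?N)) borel (\<lambda>y. \<Sum>i\<in>{1..k}. y i *\<^sub>R ?w i) = multivariate_normal 0 (matrix_inv ?I)"
      using k distr_PiM_std_normals[of "{1..k}" 1 2 ?w] covariance_eq_matrix_inv by simp
    have "(\<lambda>y. \<Sum>i\<in>{1..k}. y i *\<^sub>R ?w i) \<in> borel_measurable (PiM {1..k} (\<lambda>_. ?N))"
      by measurable
    then show ?thesis
      unfolding DL w[symmetric] by (intro integral_distr[symmetric]) measurable
  qed
  moreover have "(\<integral>y. g n y \<partial>PiM {1..k} (\<lambda>i. distr M borel (fluctuation i n)))
      = (\<integral>\<omega>. f (sqrt (real n) *\<^sub>R (?G (statistic n \<omega>) - \<theta>)) \<partial>M)" if n: "0 < n" for n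
  proof -
    have fm: "(\<lambda>\<omega>. \<lambda>i\<in>{1..k}. fluctuation i n \<omega>) \<in> measurable M (PiM {1..k} (\<lambda>_. borel))"
      by (intro measurable_restrict fluctuation_measurable)
    \<comment> \<open>Independence of the layers makes the joint law of the fluctuations the product
      of their laws, which returns the integral to \<open>M\<close>.\<close>
    have "distr M (PiM {1..k} (\<lambda>_. borel)) (\<lambda>\<omega>. \<lambda>i\<in>{1..k}. fluctuation i n \<omega>) = PiM {1..k} (\<lambda>i. distr M borel (fluctuation i n))"
      using k indep_fluctuation by (subst indep_vars_iff_distr_eq_PiM'[symmetric]) (auto intro: fluctuation_measurable)
    then have "(\<integral>y. g n y \<partial>PiM {1..k} (\<lambda>i. distr M borel (fluctuation i n)))
        = (\<integral>\<omega>. g n (\<lambda>i\<in>{1..k}. fluctuation i n \<omega>) \<partial>M)"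
      using integral_distr[OF fm g_meas[of n]] by simp
    also have "\<dots> = (\<integral>\<omega>. f (sqrt (real n) *\<^sub>R (?G (statistic n \<omega>) - \<theta>)) \<partial>M)"
      by (simp add: g_def L_def statistic_eq_fluctuation[OF n] Ga)
    finally show ?thesis .
  qed
  ultimately show ?thesis
    by (auto elim!: Lim_transform_eventually intro!: eventually_mono[OF eventually_gt_at_top[of 0]])
qed

text \<open>The estimator and the inverse map at the statistic agree eventually, almost surely. For
  a bounded test function dominated convergence then makes the difference of the expectations
  vanish.\<close>

lemma mle_asymptotically_normal:
  assumes est: "\<And>n. n \<ge> 1 \<Longrightarrow> is_mle M k t X n (est n)"
  shows "converges_in_distribution M (\<lambda>n \<omega>. sqrt (real n) *\<^sub>R (est n \<omega> - \<theta>))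
     (multivariate_normal 0 (matrix_inv (total_information k t \<theta>)))"
  unfolding converges_in_distribution_def
proof (intro allI impI, elim conjE)
  fix f :: "real^2 \<Rightarrow> real" assume f: "continuous_on UNIV f" and bdd: "bounded (range f)"
  let ?G = "inv_into detector_params (mean_map k t)"
  from bdd obtain B where fB: "\<And>x. \<bar>f x\<bar> \<le> B"
    by (auto simp: bounded_iff)
  have [measurable]: "f \<in> borel_measurable borel"
    using f by (rule borel_measurable_continuous_onI)
  note [measurable] = inv_mean_map_measurable[OF t k] statistic_measurable
  let ?Y = "\<lambda>n \<omega>. f (sqrt (real n) *\<^sub>R (est n \<omega> - \<theta>))"
  let ?Z = "\<lambda>n \<omega>. f (sqrt (real n) *\<^sub>R (?G (statistic n \<omega>) - \<theta>))"
  have Ym: "?Y n \<in> borel_measurable M" if "n \<ge> 1" for n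
  proof -
    have [measurable]: "est n \<in> borel_measurable M"
      using est[OF that] by (simp add: is_mle_def)
    show ?thesis by measurable
  qed
  have Zm: "?Z n \<in> borel_measurable M" for n
    by measurable
  have eq: "AE \<omega> in M. \<forall>\<^sub>F n in sequentially. est n \<omega> = ?G (statistic n \<omega>)"
    by (rule AE_eventually_mle_eq[OF est])
  \<comment> \<open>The shift avoids \<open>n = 0\<close>, where the estimator is unconstrained and
    need not even be measurable.\<close>
  have "(\<lambda>n. \<integral>\<omega>. ?Y (Suc n) \<omega> - ?Z (Suc n) \<omega> \<partial>M) \<longlonglongrightarrow> (\<integral>\<omega>. 0 \<partial>M)"
  proof (rule integral_dominated_convergence[where w = "\<lambda>_. 2 * B"])
    show "AE \<omega> in M. (\<lambda>n. ?Y (Suc n) \<omega> - ?Z (Suc n) \<omega>) \<longlonglongrightarrow> 0"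
      using eq
    proof eventually_elim
      case (elim \<omega>)
      then have "\<forall>\<^sub>F n in sequentially. ?Y n \<omega> - ?Z n \<omega> = 0"
        by eventually_elim simp
      then show ?case
        by (intro filterlim_compose[OF _ filterlim_Suc] tendsto_eventually)
    qed
    show "AE \<omega> in M. norm (?Y (Suc n) \<omega> - ?Z (Suc n) \<omega>) \<le> 2 * B" for n
    proof (rule AE_I2)
      fix \<omega>
      show "norm (?Y (Suc n) \<omega> - ?Z (Suc n) \<omega>) \<le> 2 * B"
        using fB[of "sqrt (real (Suc n)) *\<^sub>R (est (Suc n) \<omega> - \<theta>)"]
          fB[of "sqrt (real (Suc n)) *\<^sub>R (?G (statistic (Suc n) \<omega>) - \<theta>)"]
        unfolding real_norm_def by linarith
    qed
    show "(\<lambda>\<omega>. ?Y (Suc n) \<omega> - ?Z (Suc n) \<omega>) \<in> borel_measurable M" for n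
      by (intro borel_measurable_diff Ym Zm) simp
  qed auto
  moreover have "(\<integral>\<omega>. ?Y (Suc n) \<omega> - ?Z (Suc n) \<omega> \<partial>M) = (\<integral>\<omega>. ?Y (Suc n) \<omega> \<partial>M) - (\<integral>\<omega>. ?Z (Suc n) \<omega> \<partial>M)" for n
    using Ym[of "Suc n"] Zm[of "Suc n"] fB
    by (intro Bochner_Integration.integral_diff integrable_const_bound[where B = B]) auto
  ultimately have "(\<lambda>n. (\<integral>\<omega>. ?Y (Suc n) \<omega> \<partial>M) - (\<integral>\<omega>. ?Z (Suc n) \<omega> \<partial>M)) \<longlonglongrightarrow> 0"
    by simp
  moreover have "(\<lambda>n. \<integral>\<omega>. ?Z (Suc n) \<omega> \<partial>M) \<longlonglongrightarrow> (\<integral>x. f x \<partial>multivariate_normal 0 (matrix_inv (total_information k t \<theta>)))"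
    by (rule LIMSEQ_Suc[OF inv_statistic_asymptotically_normal[OF f fB]])
  ultimately have "(\<lambda>n. \<integral>\<omega>. ?Y (Suc n) \<omega> \<partial>M) \<longlonglongrightarrow> (\<integral>x. f x \<partial>multivariate_normal 0 (matrix_inv (total_information k t \<theta>)))"
    by (rule Lim_transform[rotated])
  then show "(\<lambda>n. \<integral>\<omega>. ?Y n \<omega> \<partial>M) \<longlonglongrightarrow> (\<integral>x. f x \<partial>multivariate_normal 0 (matrix_inv (total_information k t \<theta>)))"
    by (rule LIMSEQ_imp_Suc)
qed

end

text \<open>The invertibility conjunct guarantees that the choice made by \<open>matrix_inv\<close>
  is the genuine inverse of the Fisher information.\<close>

theorem theorem1:
  fixes M :: "'a measure" and X :: "nat \<Rightarrow> nat \<Rightarrow> 'a \<Rightarrow> nat"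
    and k :: nat and t p lam :: real and est :: "nat \<Rightarrow> 'a \<Rightarrow> real^2"
  assumes "prob_space M"
    and "k > 1" and "t > 0" and "0 < p" and "p < 1" and "lam > 0"
    and "prob_space.indep_vars M (\<lambda>_. count_space UNIV) (\<lambda>(i, j). X i j) ({1..k} \<times> {1..})"
    and "\<And>i j. i \<in> {1..k} \<Longrightarrow> j \<ge> 1 \<Longrightarrow>
           distr M (count_space UNIV) (X i j) = measure_pmf (poisson_pmf (layer_mean t i (vector [p, lam])))"
    and "\<And>n. n \<ge> 1 \<Longrightarrow> is_mle M k t X n (est n)"
  shows "(AE \<omega> in M. (\<lambda>n. est n \<omega>) \<longlonglongrightarrow> vector [p, lam])
    \<and> invertible (total_information k t (vector [p, lam]))
    \<and> converges_in_distribution M (\<lambda>n \<omega>. sqrt (real n) *\<^sub>R (est n \<omega> - vector [p, lam]))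
         (multivariate_normal 0 (matrix_inv (total_information k t (vector [p, lam]))))"
proof -
  have \<theta>: "vector [p, lam] \<in> detector_params"
    using assms(4-6) by (simp add: detector_params_def)
  interpret layered_counts M X k t "vector [p, lam]"
    using assms(1-3,7,8) \<theta> by (intro layered_counts.intro layered_counts_axioms.intro) auto
  show ?thesis
  proof (intro conjI)
    show "AE \<omega> in M. (\<lambda>n. est n \<omega>) \<longlonglongrightarrow> vector [p, lam]"
      by (rule mle_consistent[OF assms(9)])
    show "invertible (total_information k t (vector [p, lam]))"
      using det_total_information_pos[OF \<theta> assms(3,2)] by (simp add: invertible_det_nz)
    show "converges_in_distribution M (\<lambda>n \<omega>. sqrt (real n) *\<^sub>R (est n \<omega> - vector [p, lam]))
         (multivariate_normal 0 (matrix_inv (total_information k t (vector [p, lam]))))"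
      by (rule mle_asymptotically_normal[OF assms(9)])
  qed
qed

end
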